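(* Let $m,n$ be positive integers, $d=m+n$, and let $\psi:\mathbb{N}\to(0,\infty)$ be a non-increasing function with $\sum_{k=1}^\infty \psi(k)=\infty$. Fix $\mathbf{N}=(N_1,\dots,N_d)\in\mathbb{N}^d$ and $\mathbf{v}=(v_1,\dots,v_d)\in\mathbb{Z}^d$. Then for Lebesgue-almost every $\theta\in \mathrm{M}_{m,n}(\mathbb{R})$ there are infinitely many $(\mathbf{p},\mathbf{q})\in\mathbb{Z}^m\times\mathbb{Z}^n$ satisfying $$\|\theta\mathbf{q}+\mathbf{p}\|^m\le \psi\left(\|\mathbf{q}\|^n\right)$$ such that $p_j\equiv v_j \pmod{N_j}$ for every $1\le j\le m$ and $q_j\equiv v_{m+j}\pmod{N_{m+j}}$ for every $1\le j\le n$.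
   Context: $\mathrm{M}_{m,n}(\mathbb{R})$ denotes the space of real $m\times n$ matrices. $\|\cdot\|$ denotes the maximum norm on $\mathbb{R}^k$ for any $k$. For $\mathbf{p}\in\mathbb{Z}^m$, $\mathbf{q}\in\mathbb{Z}^n$, their coordinates are $p_1,\dots,p_m$ and $q_1,\dots,q_n$. *)

theory Defs
  imports "HOL-Analysis.Analysis"
begin

definition supnorm :: "('a::linordered_idom)^'k \<Rightarrow> 'a" where
  "supnorm x = Max (range (\<lambda>i. \<bar>x $ i\<bar>))"

end

theory Submission
  imports Defs
begin

text \<open>
  Fix all columns of \<open>\<theta>\<close> except the \<open>j\<close>-th one and let that column, \<open>x\<close>, vary. A pair \<open>(p, q)\<close> is a
  good approximation if \<open>x\<close> is close to the resonant point \<open>- (\<theta> q + p) / q\<^sub>j\<close>. A matrix without short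
  integer vectors at scale \<open>T\<close> has bounded covering radius at that scale, which yields good approximations
  in every residue class modulo \<open>N\<close> with \<open>T \<le> q\<^sub>j\<close> and \<open>q\<close> at most a constant times \<open>T\<close>. By a direct count,
  at most half of the points \<open>x\<close> of a ball have short vectors with \<open>q\<^sub>j \<noteq> 0\<close>; those with \<open>q\<^sub>j = 0\<close> are excluded
  by the Borel-Cantelli lemma in the remaining columns. So the resonant points of every large scale are
  dense in half of any ball. Along a sparse geometric sequence of scales one can then choose disjoint balls
  around them that fill a fixed proportion of any given ball. Hence the set of \<open>x\<close> with only finitely many
  solutions is porous, therefore null, and Fubini's theorem gives the result for almost every \<open>\<theta>\<close>.
\<close>

text \<open>Fixing all columns but one turns the resonant sets, which are affine subspaces of the
  matrix space, into points, so plain balls suffice. The divergence half of Borel-Cantelli would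
  require some independence of the approximation sets. Disjoint balls avoid this: their volumes
  simply add up, and since the proportion gained is the same in every ball, porosity takes the place
  of a zero-one law. The congruences cost only constants: all moduli are replaced by their product
  \<open>N\<close>, and a lattice of bounded covering radius has points near every inhomogeneous
  shift, in particular near those that encode residues modulo \<open>N\<close>. The constants do not
  depend on the ball: \<open>\<epsilon>\<close> keeps the set of points with short vectors to at
  most half of a ball, \<open>K\<close> outweighs \<open>\<epsilon>\<close> in Blichfeldt's
  principle, \<open>2 * N * K + 1\<close> bounds the resulting approximations, and the ratio
  \<open>M\<close> makes the room blocked by earlier scales sum like a geometric series. Only the
  first scale used depends on the ball.\<close>

section \<open>Porous Borel sets are null\<close>

text \<open>Take an open \<open>U\<close> around \<open>F\<close> with \<open>U - F\<close> of
  measure below \<open>e\<close>. By Vitali, disjoint balls inside \<open>U\<close> exhaust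
  \<open>U\<close> up to a null set, and each of them has at least the proportion \<open>c\<close>
  outside \<open>F\<close>. Summing gives that \<open>c\<close> times the measure of
  \<open>F\<close> is at most the measure of \<open>U - F\<close>, hence at most
  \<open>e\<close>.\<close>

lemma null_sets_if_porous:
  fixes F :: "'a::euclidean_space set" and c :: real
  assumes F: "F \<in> sets borel" and c: "c > 0"
    and por: "\<And>x r. r > 0 \<Longrightarrow> ennreal c * emeasure lborel (ball x r) \<le> emeasure lborel (ball x r - F)"
  shows "F \<in> null_sets lborel"
proof -
  have bound: "ennreal c * emeasure lborel F \<le> ennreal e" if e: "e > 0" for e :: real
  proof -
    have "F \<in> sets lebesgue" using F by simp
    then obtain U where U: "open U" "F \<subseteq> U" "emeasure lebesgue (U - F) < ennreal e"
      using sets_lebesgue_outer_open[OF _ e] by metis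
    define K where "K = {(a, r). 0 < r \<and> ball a r \<subseteq> U}"
    have cov: "\<exists>i. i \<in> K \<and> x \<in> ball (fst i) (snd i) \<and> snd i < d" if x: "x \<in> U" and d: "0 < d" for x d
    proof -
      obtain s where "s > 0" "ball x s \<subseteq> U"
        using U(1) x openE by blast
      then have "(x, min s (d/2)) \<in> K"
        using d by (auto simp: K_def)
      moreover have "x \<in> ball x (min s (d/2))" "min s (d/2) < d"
        using d \<open>s > 0\<close> by auto
      ultimately show ?thesis
        by (intro exI[of _ "(x, min s (d/2))"]) simp
    qed
    obtain C where C: "countable C" "C \<subseteq> K"
      "pairwise (\<lambda>i j. disjnt (ball (fst i) (snd i)) (ball (fst j) (snd j))) C"
      "negligible (U - (\<Union>i\<in>C. ball (fst i) (snd i)))"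
      by (rule Vitali_covering_theorem_balls[of U K fst snd, OF cov])
    let ?B = "\<lambda>i. ball (fst i) (snd i :: real) :: 'a set"
    have disj: "disjoint_family_on ?B C"
      using C(3) by (auto simp: disjoint_family_on_def pairwise_def disjnt_def)
    have V: "(\<Union>i\<in>C. ?B i) \<in> sets lborel" and Us: "U \<in> sets lborel"
      using U(1) by (auto intro!: borel_open open_UN)
    have UF: "U - F \<in> sets lborel" and UV: "U - (\<Union>i\<in>C. ?B i) \<in> sets lborel"
      using F V Us by simp_all
    have N: "U - (\<Union>i\<in>C. ?B i) \<in> null_sets lborel"
      using C(4) UV by (simp add: negligible_iff_null_sets null_sets_completion_iff)
    have "emeasure lborel F \<le> emeasure lborel ((\<Union>i\<in>C. ?B i) \<union> (U - (\<Union>i\<in>C. ?B i)))"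
      using U(2) sets.Un[OF V UV] by (intro emeasure_mono) blast
    also have "\<dots> = emeasure lborel (\<Union>i\<in>C. ?B i)"
      using V N by (intro emeasure_Un_null_set) auto
    also have "\<dots> = (\<integral>\<^sup>+i. emeasure lborel (?B i) \<partial>count_space C)"
      using C(1) disj by (intro emeasure_UN_countable) auto
    finally have "ennreal c * emeasure lborel F
        \<le> ennreal c * (\<integral>\<^sup>+i. emeasure lborel (?B i) \<partial>count_space C)"
      by (intro mult_left_mono) auto
    also have "\<dots> = (\<integral>\<^sup>+i. ennreal c * emeasure lborel (?B i) \<partial>count_space C)"
      by (rule nn_integral_cmult[symmetric]) auto
    also have "\<dots> \<le> (\<integral>\<^sup>+i. emeasure lborel (?B i - F) \<partial>count_space C)"
      using C(2) por by (intro nn_integral_mono) (auto simp: K_def case_prod_beta)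
    also have "\<dots> = emeasure lborel (\<Union>i\<in>C. ?B i - F)"
    proof (intro emeasure_UN_countable[symmetric])
      show "disjoint_family_on (\<lambda>i. ?B i - F) C"
        by (rule disjoint_family_on_bisimulation[OF disj]) blast
    qed (use C(1) F in auto)
    also have "\<dots> \<le> emeasure lborel (U - F)"
    proof (intro emeasure_mono)
      have "?B i \<subseteq> U" if "i \<in> C" for i
        using subsetD[OF C(2) that] by (simp add: K_def case_prod_beta)
      then show "(\<Union>i\<in>C. ?B i - F) \<subseteq> U - F" by blast
    qed (rule UF)
    also have "\<dots> = emeasure lebesgue (U - F)"
      using UF by (subst emeasure_completion) auto
    finally show ?thesis using U(3) by simp
  qed
  have "ennreal c * emeasure lborel F \<le> 0"
    by (rule ennreal_le_epsilon) (simp add: bound)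
  then have "emeasure lborel F = 0" using c by auto
  then show ?thesis using F by auto
qed

section \<open>Covering radius of a lattice without short vectors\<close>

definition of_int_vec :: "int^'k \<Rightarrow> real^'k" where
  "of_int_vec p = (\<chi> i. real_of_int (p $ i))"

lemma of_int_vec_nth [simp]: "of_int_vec p $ i = real_of_int (p $ i)"
  by (simp add: of_int_vec_def)

lemma of_int_vec_0 [simp]: "of_int_vec 0 = 0"
  by (simp add: vec_eq_iff)

lemma of_int_vec_add: "of_int_vec (p + q) = of_int_vec p + of_int_vec q"
  by (simp add: vec_eq_iff)

lemma of_int_vec_diff: "of_int_vec (p - q) = of_int_vec p - of_int_vec q"
  by (simp add: vec_eq_iff)

abbreviation of_int_pair :: "(int^'m) \<times> (int^'n) \<Rightarrow> (real^'m) \<times> (real^'n)" where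
  "of_int_pair z \<equiv> map_prod of_int_vec of_int_vec z"

lemma of_int_pair_add: "of_int_pair (z + w) = of_int_pair z + of_int_pair w"
  by (cases z; cases w) (simp add: of_int_vec_add)

lemma of_int_pair_diff: "of_int_pair (z - w) = of_int_pair z - of_int_pair w"
  by (cases z; cases w) (simp add: of_int_vec_diff)

lemma of_int_pair_0 [simp]: "of_int_pair 0 = 0"
  by (simp add: zero_prod_def)

lemma emeasure_lborel_translate:
  fixes A :: "'a::euclidean_space set"
  assumes "A \<in> sets borel"
  shows "emeasure lborel {x. c + x \<in> A} = emeasure lborel A"
proof -
  have "emeasure lborel A = emeasure (distr lborel borel ((+) c)) A"
    by (simp add: lborel_distr_plus)
  also have "\<dots> = emeasure lborel ((+) c -` A \<inter> space lborel)"
    using assms by (intro emeasure_distr) auto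
  finally show ?thesis by (simp add: vimage_def)
qed

text \<open>Blichfeldt's principle in contrapositive form: cut \<open>U\<close> along the integer
  translates of the unit cube and move all pieces back into that cube. An overlap of two pieces
  would give two points of \<open>U\<close> that differ by a nonzero integer vector.\<close>

lemma blichfeldt:
  fixes U :: "((real^'m::finite) \<times> (real^'n::finite)) set"
  assumes U: "U \<in> sets borel"
    and disj: "\<And>u z. u \<in> U \<Longrightarrow> u + of_int_pair z \<in> U \<Longrightarrow> z = 0"
  shows "emeasure lborel U \<le> 1"
proof -
  \<comment> \<open>Half-open, so that the translates partition the space and the cell of a point is
    read off from floors. For the final bound it is enough that \<open>Q\<close> lies in the closed
    unit cube.\<close>
  define Q :: "((real^'m) \<times> (real^'n)) set"
    where "Q = {u. (\<forall>i. 0 \<le> fst u $ i \<and> fst u $ i < 1) \<and> (\<forall>j. 0 \<le> snd u $ j \<and> snd u $ j < 1)}"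
  define cell where "cell z = {u. u - of_int_pair z \<in> Q}" for z :: "(int^'m) \<times> (int^'n)"
  have [measurable]: "(\<lambda>u :: (real^'m) \<times> (real^'n). fst u $ i) \<in> borel_measurable borel"
    "(\<lambda>u :: (real^'m) \<times> (real^'n). snd u $ j) \<in> borel_measurable borel" for i j
    by (intro borel_measurable_continuous_onI continuous_intros)+
  have Q: "Q \<in> sets borel"
    unfolding Q_def by measurable
  have shiftm: "(\<lambda>u. c + u) \<in> borel_measurable borel" for c :: "(real^'m) \<times> (real^'n)"
    by simp
  have cellm: "cell z \<in> sets borel" for z
  proof -
    have "(\<lambda>u. u - of_int_pair z) -` Q \<inter> space borel \<in> sets borel"
      by (rule measurable_sets[OF _ Q]) simp
    then show ?thesis by (simp add: cell_def vimage_def)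
  qed
  have cell_floor: "u \<in> cell z \<longleftrightarrow> z = ((\<chi> i. \<lfloor>fst u $ i\<rfloor>), (\<chi> j. \<lfloor>snd u $ j\<rfloor>))" for u z
    by (cases z) (simp add: cell_def Q_def vec_eq_iff floor_eq_iff eq_commute[of _ "\<lfloor>_\<rfloor>"]
        algebra_simps)
  have "emeasure lborel U = emeasure lborel (\<Union>z. U \<inter> cell z)"
    by (rule arg_cong[where f = "emeasure lborel"]) (auto simp: cell_floor)
  also have "\<dots> = (\<integral>\<^sup>+z. emeasure lborel (U \<inter> cell z) \<partial>count_space UNIV)"
    using U cellm by (intro emeasure_UN_countable) (auto simp: disjoint_family_on_def cell_floor)
  also have "\<dots> = (\<integral>\<^sup>+z. emeasure lborel {u. of_int_pair z + u \<in> U \<inter> cell z} \<partial>count_space UNIV)"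
    using U cellm by (simp add: emeasure_lborel_translate del: Int_iff)
  also have "\<dots> = emeasure lborel (\<Union>z. {u. of_int_pair z + u \<in> U \<inter> cell z})"
  proof (intro emeasure_UN_countable[symmetric])
    show "{u. of_int_pair z + u \<in> U \<inter> cell z} \<in> sets lborel" for z
    proof -
      have "(\<lambda>u. of_int_pair z + u) -` (U \<inter> cell z) \<inter> space borel \<in> sets borel"
        by (rule measurable_sets[OF shiftm]) (use U cellm in auto)
      then show ?thesis by (simp add: vimage_def del: Int_iff)
    qed
    show "disjoint_family (\<lambda>z. {u. of_int_pair z + u \<in> U \<inter> cell z})"
      unfolding disjoint_family_on_def
    proof (intro ballI impI, rule ccontr)
      fix z w :: "(int^'m) \<times> (int^'n)"
      assume zw: "z \<noteq> w" and
        "{u. of_int_pair z + u \<in> U \<inter> cell z} \<inter> {u. of_int_pair w + u \<in> U \<inter> cell w} \<noteq> {}"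
      then obtain u where u: "of_int_pair z + u \<in> U" "of_int_pair w + u \<in> U" by blast
      have "of_int_pair w + u = (of_int_pair z + u) + of_int_pair (w - z)"
        by (simp only: of_int_pair_diff) simp
      then have "w - z = 0" using disj[OF u(1)] u(2) by metis
      then show False using zw by simp
    qed
  qed auto
  also have "\<dots> \<le> emeasure lborel (cbox 0 One :: ((real^'m) \<times> (real^'n)) set)"
  proof (rule emeasure_mono)
    have "0 \<le> u \<bullet> b \<and> u \<bullet> b \<le> 1" if "u \<in> Q" "b \<in> Basis" for u b
      using that by (auto simp: Q_def Basis_prod_def Basis_vec_def inner_axis inner_prod_def less_imp_le)
    then have "Q \<subseteq> cbox 0 One"
      by (auto simp: mem_box)
    then show "(\<Union>z. {u. of_int_pair z + u \<in> U \<inter> cell z}) \<subseteq> cbox 0 (One :: (real^'m) \<times> (real^'n))"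
      by (auto simp: cell_def)
  qed auto
  also have "\<dots> = 1"
    by simp
  finally show ?thesis .
qed

text \<open>
  If the distance \<open>f\<close> to the lattice is large somewhere, it takes the values \<open>0, \<epsilon>, 2 \<epsilon>, \<dots>\<close>
  along a segment, and the balls of radius \<open>\<epsilon> / 2\<close> around these points are disjoint modulo the lattice.
\<close>

lemma covering_radius:
  fixes G :: "(real^'m::finite) \<times> (real^'n::finite) \<Rightarrow> real"
  assumes tri: "\<And>x y. G (x + y) \<le> G x + G y"
    and scale: "\<And>c x. G (c *\<^sub>R x) = \<bar>c\<bar> * G x"
    and op: "\<And>r. {u. G u < r} \<in> sets borel"
    and eps: "\<epsilon> > 0"
    and vol: "emeasure lborel {u. G u < \<epsilon> / 2} = ennreal w"
    and K: "real K * w > 1"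
    and short: "\<And>z. z \<noteq> 0 \<Longrightarrow> \<epsilon> \<le> G (of_int_pair z)"
  shows "\<exists>z. G (y + of_int_pair z) \<le> real K * \<epsilon>"
proof (rule ccontr)
  assume "\<not> ?thesis"
  then have far: "real K * \<epsilon> \<le> G (y + of_int_pair z)" for z
    by (meson linorder_not_less order.strict_implies_order)
  have G0: "G 0 = 0" using scale[of 0 0] by simp
  have neg: "G (- x) = G x" for x using scale[of "-1" x] by simp
  have nonneg: "0 \<le> G x" for x using tri[of x "- x"] by (simp add: neg G0)
  define f where "f x = (INF z. G (x + of_int_pair z))" for x
  have bdd: "bdd_below (range (\<lambda>z. G (x + of_int_pair z)))" for x
    using nonneg by (meson bdd_belowI2)
  have f_le: "f x \<le> G (x + of_int_pair z)" for x z
    unfolding f_def by (rule cINF_lower[OF bdd]) simp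
  \<comment> \<open>The free \<open>z\<close> makes this a Lipschitz bound modulo the lattice;
    \<open>z = 0\<close> gives continuity along the segment, other \<open>z\<close> are needed in
    \<open>key\<close>.\<close>
  have lip: "f x \<le> f x' + G (x - x' + of_int_pair z)" for x x' z
  proof -
    have "f x - G (x - x' + of_int_pair z) \<le> G (x' + of_int_pair z')" for z'
    proof -
      have "f x \<le> G (x + of_int_pair (z + z'))" by (rule f_le)
      also have "x + of_int_pair (z + z') = (x - x' + of_int_pair z) + (x' + of_int_pair z')"
        by (simp only: of_int_pair_add) simp
      also have "G \<dots> \<le> G (x - x' + of_int_pair z) + G (x' + of_int_pair z')" by (rule tri)
      finally show ?thesis by simp
    qed
    then have "f x - G (x - x' + of_int_pair z) \<le> f x'"
      unfolding f_def[of x'] by (intro cINF_greatest) auto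
    then show ?thesis by simp
  qed
  have f0: "f 0 \<le> 0" using f_le[of 0 0] by (simp add: G0)
  have fy: "real K * \<epsilon> \<le> f y"
    unfolding f_def using far by (intro cINF_greatest) auto
  have lip1: "\<bar>f (a *\<^sub>R y) - f (b *\<^sub>R y)\<bar> \<le> \<bar>a - b\<bar> * G y" for a b
  proof -
    have *: "f (a *\<^sub>R y) \<le> f (b *\<^sub>R y) + \<bar>a - b\<bar> * G y" for a b
      using lip[of "a *\<^sub>R y" "b *\<^sub>R y" 0] by (simp add: scaleR_diff_left[symmetric] scale)
    show ?thesis using *[of a b] *[of b a] by (auto simp: abs_minus_commute abs_le_iff)
  qed
  have cont: "continuous_on {0..1} (\<lambda>a. f (a *\<^sub>R y))"
  proof (rule lipschitz_on_continuous_on[of "G y"])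
    show "(G y)-lipschitz_on {0..1} (\<lambda>a. f (a *\<^sub>R y))"
      using lip1 nonneg by (auto simp: lipschitz_on_def dist_real_def mult.commute)
  qed
  have "\<exists>a. f (a *\<^sub>R y) = real i * \<epsilon>" if "i < K" for i
  proof -
    have "real i * \<epsilon> \<le> f (1 *\<^sub>R y)"
      using fy that eps by (simp add: order.trans[OF mult_right_mono[of "real i" "real K" \<epsilon>]])
    moreover have "f (0 *\<^sub>R y) \<le> real i * \<epsilon>"
      using f0 eps by (simp add: order.trans[of "f 0" 0])
    ultimately show ?thesis
      using IVT'[of "\<lambda>a. f (a *\<^sub>R y)" 0 "real i * \<epsilon>" 1] cont by auto
  qed
  then obtain a where a: "\<And>i. i < K \<Longrightarrow> f (a i *\<^sub>R y) = real i * \<epsilon>" by metis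
  define v where "v i = a i *\<^sub>R y" for i
  define U where "U i = {u. G (u - v i) < \<epsilon> / 2}" for i
  have U_alt: "U i = {u. - v i + u \<in> {u. G u < \<epsilon> / 2}}" for i
    by (simp add: U_def)
  have U_sets: "U i \<in> sets borel" for i
  proof -
    have "(\<lambda>u. - v i + u) -` {u. G u < \<epsilon> / 2} \<inter> space borel \<in> sets borel"
      by (rule measurable_sets[OF _ op]) simp
    then show ?thesis by (simp add: U_def vimage_def)
  qed
  have U_vol: "emeasure lborel (U i) = ennreal w" for i
    unfolding U_alt emeasure_lborel_translate[OF op] by (rule vol)
  \<comment> \<open>The centres are then closer than \<open>\<epsilon>\<close> modulo the lattice,
    so their \<open>f\<close>-values \<open>i * \<epsilon>\<close> and \<open>j * \<epsilon>\<close>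
    differ by less than \<open>\<epsilon>\<close> and \<open>i = j\<close>. Now \<open>z\<close>
    itself is shorter than \<open>\<epsilon>\<close>, hence zero.\<close>
  have key: "i = j \<and> z = 0" if "u \<in> U i" "u + of_int_pair z \<in> U j" "i < K" "j < K" for u z i j
  proof -
    have "v j - v i + of_int_pair (- z) = (u - v i) + (- (u + of_int_pair z - v j))"
      using of_int_pair_diff[of 0 z] by (simp add: algebra_simps)
    then have "G (v j - v i + of_int_pair (- z)) \<le> G (u - v i) + G (u + of_int_pair z - v j)"
      by (metis tri neg)
    then have lt: "G (v j - v i + of_int_pair (- z)) < \<epsilon>"
      using that by (simp add: U_def)
    have "v i - v j + of_int_pair z = - (v j - v i + of_int_pair (- z))"
      using of_int_pair_diff[of 0 z] by (simp add: algebra_simps)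
    then have lt': "G (v i - v j + of_int_pair z) < \<epsilon>"
      using lt neg by metis
    have "f (v j) < f (v i) + \<epsilon>" "f (v i) < f (v j) + \<epsilon>"
      using lip[of "v j" "v i" "- z"] lip[of "v i" "v j" z] lt lt' by linarith+
    then have "real j * \<epsilon> < (real i + 1) * \<epsilon>" "real i * \<epsilon> < (real j + 1) * \<epsilon>"
      using a that by (auto simp: v_def algebra_simps)
    then have "real j < real i + 1" "real i < real j + 1"
      using eps by (simp_all add: mult_less_cancel_right)
    then have "i = j" by linarith
    then show ?thesis using lt' short[of z] by fastforce
  qed
  have "ennreal (real K * w) = (\<Sum>i<K. emeasure lborel (U i))"
    using K by (simp add: U_vol ennreal_mult' ennreal_of_nat_eq_real_of_nat)
  also have "\<dots> = emeasure lborel (\<Union>i<K. U i)"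
  proof (intro sum_emeasure)
    show "disjoint_family_on U {..<K}"
      unfolding disjoint_family_on_def
      using key[where z = 0] by auto
  qed (use U_sets in auto)
  also have "\<dots> \<le> 1"
  proof (rule blichfeldt)
    show "z = 0" if "u \<in> (\<Union>i<K. U i)" "u + of_int_pair z \<in> (\<Union>i<K. U i)" for u z
      using key that by blast
  qed (use U_sets in auto)
  finally show False using K by simp
qed

section \<open>The maximum norm and volumes of boxes\<close>

lemma supnorm_le_iff: "supnorm x \<le> r \<longleftrightarrow> (\<forall>i. \<bar>x $ i\<bar> \<le> r)"
  by (simp add: supnorm_def)

lemma supnorm_less_iff: "supnorm x < r \<longleftrightarrow> (\<forall>i. \<bar>x $ i\<bar> < r)"
  by (simp add: supnorm_def)

lemma abs_le_supnorm: "\<bar>x $ i\<bar> \<le> supnorm x"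
  using supnorm_le_iff[of x "supnorm x"] by simp

lemma supnorm_nonneg: "0 \<le> supnorm x"
  using order.trans[OF abs_ge_zero abs_le_supnorm] .

lemma supnorm_add: "supnorm (x + y) \<le> supnorm x + supnorm y"
  unfolding supnorm_le_iff
  using order.trans[OF abs_triangle_ineq add_mono[OF abs_le_supnorm abs_le_supnorm]] by auto

lemma supnorm_scaleR: "supnorm (c *\<^sub>R x) = \<bar>c\<bar> * supnorm x" for x :: "real^'k"
proof (rule antisym)
  show "supnorm (c *\<^sub>R x) \<le> \<bar>c\<bar> * supnorm x"
    unfolding supnorm_le_iff by (auto simp: abs_mult intro!: mult_left_mono abs_le_supnorm)
  have "supnorm x \<in> range (\<lambda>i. \<bar>x $ i\<bar>)"
    unfolding supnorm_def by (rule Max_in) auto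
  then obtain i where "supnorm x = \<bar>x $ i\<bar>" by blast
  then show "\<bar>c\<bar> * supnorm x \<le> supnorm (c *\<^sub>R x)"
    using abs_le_supnorm[of "c *\<^sub>R x" i] by (simp add: abs_mult)
qed

lemma emeasure_supnorm_less:
  fixes c :: "real^'k"
  assumes "r \<ge> 0"
  shows "emeasure lborel {x. supnorm (x - c) < r} = ennreal ((2 * r) ^ CARD('k))"
proof -
  let ?a = "\<chi> i. c $ i - r" and ?b = "\<chi> i. c $ i + r"
  have "{x. supnorm (x - c) < r} = box ?a ?b"
    by (auto simp: supnorm_less_iff mem_box_cart abs_less_iff algebra_simps)
  moreover have "cbox ?a ?b \<noteq> {}"
    using assms by (auto simp: interval_ne_empty_cart)
  then have "measure lborel (cbox ?a ?b) = (2 * r) ^ CARD('k)"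
    by (simp add: content_cbox_cart)
  moreover have "emeasure lborel (box ?a ?b) = emeasure lborel (cbox ?a ?b)"
    by (simp add: emeasure_lborel_box_eq emeasure_lborel_cbox_eq)
  moreover have "emeasure lborel (cbox ?a ?b) = ennreal (measure lborel (cbox ?a ?b))"
    by (rule emeasure_eq_ennreal_measure) (simp add: emeasure_lborel_cbox_eq)
  ultimately show ?thesis by simp
qed

lemma emeasure_supnorm_le:
  fixes c :: "real^'k"
  assumes "r \<ge> 0"
  shows "emeasure lborel {x. supnorm (x - c) \<le> r} = ennreal ((2 * r) ^ CARD('k))"
proof -
  let ?a = "\<chi> i. c $ i - r" and ?b = "\<chi> i. c $ i + r"
  have "{x. supnorm (x - c) \<le> r} = cbox ?a ?b"
    by (auto simp: supnorm_le_iff mem_box_cart abs_le_iff algebra_simps)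
  moreover have "cbox ?a ?b \<noteq> {}"
    using assms by (auto simp: interval_ne_empty_cart)
  then have "measure lborel (cbox ?a ?b) = (2 * r) ^ CARD('k)"
    by (simp add: content_cbox_cart)
  moreover have "emeasure lborel (cbox ?a ?b) = ennreal (measure lborel (cbox ?a ?b))"
    by (rule emeasure_eq_ennreal_measure) (simp add: emeasure_lborel_cbox_eq)
  ultimately show ?thesis by simp
qed

lemma borel_measurable_vec_nth [measurable]:
  "(\<lambda>x :: real^'k. x $ i) \<in> borel_measurable borel"
  by (intro borel_measurable_continuous_onI continuous_intros)

lemma open_supnorm_less: "open {u. supnorm (f u) < r}"
  if "continuous_on UNIV f" for f :: "'a::topological_space \<Rightarrow> real^'k"
proof -
  have "{u. supnorm (f u) < r} = (\<Inter>i. {u. \<bar>f u $ i\<bar> < r})"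
    by (auto simp: supnorm_less_iff)
  moreover have "open {u. \<bar>f u $ i\<bar> < r}" for i
    by (intro open_Collect_less continuous_intros that)
  ultimately show ?thesis by auto
qed

text \<open>The shear by \<open>X\<close> preserves volume: for fixed second component the slice is
  a translate of a cube, so Fubini yields the volume of the unsheared box.\<close>

lemma emeasure_sheared_box:
  fixes X :: "real^'n^'m"
  assumes "r \<ge> 0" "r' \<ge> 0"
  shows "emeasure lborel {u. supnorm (fst u + X *v snd u) < r \<and> supnorm (snd u) < r'}
    = ennreal ((2 * r) ^ CARD('m) * (2 * r') ^ CARD('n))" (is "emeasure _ ?U = _")
proof -
  have "open {u. supnorm (fst u + X *v snd u) < r}" "open {u. supnorm (snd u :: real^'n) < r'}"
    by (intro open_supnorm_less continuous_intros
        bounded_linear.continuous_on[OF matrix_vector_mul_bounded_linear])+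
  then have U: "?U \<in> sets (lborel \<Otimes>\<^sub>M lborel)"
    unfolding lborel_prod sets_lborel Collect_conj_eq by (intro borel_open open_Int)
  have slice: "emeasure lborel ((\<lambda>a. (a, b)) -` ?U)
      = ennreal ((2 * r) ^ CARD('m)) * indicator {b. supnorm (b - 0) < r'} b" for b
  proof -
    have "(\<lambda>a. (a, b)) -` ?U = (if supnorm b < r' then {a. supnorm (a - (- (X *v b))) < r} else {})"
      by auto
    then show ?thesis
      using emeasure_supnorm_less[of r "- (X *v b)"] assms by auto
  qed
  have "emeasure lborel ?U = emeasure (lborel \<Otimes>\<^sub>M lborel) ?U"
    by (simp add: lborel_prod)
  also have "\<dots> = (\<integral>\<^sup>+b. emeasure lborel ((\<lambda>a. (a, b)) -` ?U) \<partial>lborel)"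
    by (rule lborel_pair.emeasure_pair_measure_alt2[OF U])
  also have "\<dots> = ennreal ((2 * r) ^ CARD('m)) * emeasure lborel {b :: real^'n. supnorm (b - 0) < r'}"
    unfolding slice
    by (rule nn_integral_cmult_indicator) (auto intro!: borel_open open_supnorm_less continuous_intros)
  also have "\<dots> = ennreal ((2 * r) ^ CARD('m)) * ennreal ((2 * r') ^ CARD('n))"
    using emeasure_supnorm_less[of r' "0 :: real^'n"] assms by simp
  finally show ?thesis
    using assms by (simp add: ennreal_mult'')
qed

section \<open>Integer points in prescribed residue classes\<close>

lemma inhomogeneous_solution:
  fixes X :: "real^'n^'m" and \<alpha> :: "real^'m" and \<beta> :: "real^'n"
  assumes s: "s > 0" and T: "T > 0" and vol: "s ^ CARD('m) * T ^ CARD('n) = 1"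
    and eps: "\<epsilon> > 0" and K: "real K * \<epsilon> ^ (CARD('m) + CARD('n)) > 1"
    and short: "\<And>p q. supnorm (of_int_vec q) \<le> \<epsilon> * T \<Longrightarrow>
      supnorm (X *v of_int_vec q + of_int_vec p) \<le> \<epsilon> * s \<Longrightarrow> p = 0 \<and> q = 0"
  obtains p q where "supnorm (of_int_vec q + \<beta>) \<le> real K * \<epsilon> * T"
    "supnorm (X *v (of_int_vec q + \<beta>) + of_int_vec p + \<alpha>) \<le> real K * \<epsilon> * s"
proof -
  \<comment> \<open>The matrix is absorbed into the norm, so the lattice stays the integer lattice
    of \<open>blichfeldt\<close>. Since \<open>s ^ m * T ^ n = 1\<close>, the ball of radius
    \<open>\<epsilon> / 2\<close> has volume \<open>\<epsilon> ^ (m + n)\<close>, which is the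
    \<open>w\<close> of \<open>covering_radius\<close>.\<close>
  define G where "G u = max (supnorm (fst u + X *v snd u) / s) (supnorm (snd u) / T)" for u
  have G_less: "G u < r \<longleftrightarrow> supnorm (fst u + X *v snd u) < r * s \<and> supnorm (snd u) < r * T" for u r
    using s T by (simp add: G_def divide_less_eq)
  have G_le: "G u \<le> r \<longleftrightarrow> supnorm (fst u + X *v snd u) \<le> r * s \<and> supnorm (snd u) \<le> r * T" for u r
    using s T by (simp add: G_def divide_le_eq)
  have "\<exists>z. G ((\<alpha>, \<beta>) + of_int_pair z) \<le> real K * \<epsilon>"
  proof (rule covering_radius)
    show "G (x + y) \<le> G x + G y" for x y
    proof -
      have eq: "fst (x + y) + X *v snd (x + y) = (fst x + X *v snd x) + (fst y + X *v snd y)"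
        by (simp add: matrix_vector_right_distrib)
      have "supnorm (fst (x + y) + X *v snd (x + y)) / s
          \<le> supnorm (fst x + X *v snd x) / s + supnorm (fst y + X *v snd y) / s"
        unfolding eq add_divide_distrib[symmetric] using s by (intro divide_right_mono supnorm_add) auto
      moreover have "supnorm (snd (x + y)) / T \<le> supnorm (snd x) / T + supnorm (snd y) / T"
        unfolding add_divide_distrib[symmetric] snd_add using T
        by (intro divide_right_mono supnorm_add) auto
      ultimately show ?thesis by (auto simp: G_def)
    qed
    show "G (c *\<^sub>R x) = \<bar>c\<bar> * G x" for c x
    proof -
      have eq: "fst (c *\<^sub>R x) + X *v snd (c *\<^sub>R x) = c *\<^sub>R (fst x + X *v snd x)"
        by (simp add: matrix_vector_mult_scaleR scaleR_right_distrib)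
      have "supnorm (fst (c *\<^sub>R x) + X *v snd (c *\<^sub>R x)) = \<bar>c\<bar> * supnorm (fst x + X *v snd x)"
        unfolding eq by (rule supnorm_scaleR)
      moreover have "supnorm (snd (c *\<^sub>R x)) = \<bar>c\<bar> * supnorm (snd x)"
        by (simp add: supnorm_scaleR)
      ultimately show ?thesis
        by (simp only: G_def) (simp add: max_mult_distrib_left)
    qed
    have "open {u. supnorm (fst u + X *v snd u) < r * s}" "open {u. supnorm (snd u :: real^'n) < r *
      T}" for r
      by (intro open_supnorm_less continuous_intros
          bounded_linear.continuous_on[OF matrix_vector_mul_bounded_linear])+
    then show "{u. G u < r} \<in> sets borel" for r
      unfolding G_less Collect_conj_eq by (intro borel_open open_Int)
    have "emeasure lborel {u. G u < \<epsilon> / 2} = ennreal ((\<epsilon> * s) ^ CARD('m) * (\<epsilon> * T) ^ CARD('n))"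
      unfolding G_less using emeasure_sheared_box[of "\<epsilon> / 2 * s" "\<epsilon> / 2 * T" X] s T eps by simp
    also have "(\<epsilon> * s) ^ CARD('m) * (\<epsilon> * T) ^ CARD('n) = \<epsilon> ^ (CARD('m) + CARD('n))"
      using vol by (simp add: power_mult_distrib power_add mult.assoc mult.left_commute)
    finally show "emeasure lborel {u. G u < \<epsilon> / 2} = ennreal (\<epsilon> ^ (CARD('m) + CARD('n)))" .
    show "\<epsilon> \<le> G (of_int_pair z)" if "z \<noteq> 0" for z
    proof (rule ccontr)
      assume "\<not> ?thesis"
      then have "supnorm (of_int_vec (fst z) + X *v of_int_vec (snd z)) < \<epsilon> * s"
        "supnorm (of_int_vec (snd z) :: real^'n) < \<epsilon> * T"
        by (auto simp: G_less not_le)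
      then have "fst z = 0 \<and> snd z = 0"
        using short[of "snd z" "fst z"] by (simp add: add.commute)
      then show False using that by (simp add: prod_eq_iff)
    qed
  qed (use eps K in auto)
  then obtain p q where "G (\<alpha> + of_int_vec p, \<beta> + of_int_vec q) \<le> real K * \<epsilon>"
    by auto
  then show ?thesis
    by (intro that[of q p]) (simp_all add: G_le algebra_simps)
qed

text \<open>
  The inhomogeneous shift is chosen such that it also forces all entries of \<open>q\<close> to be of size at least \<open>T\<close>.
\<close>

lemma congruent_solution:
  fixes X :: "real^'n^'m" and w :: "int^'m" and v :: "int^'n"
  assumes s: "s > 0" and T: "T > 0" and vol: "s ^ CARD('m) * T ^ CARD('n) = 1"
    and eps: "0 < \<epsilon>" "\<epsilon> \<le> 1" and K: "real K * \<epsilon> ^ (CARD('m) + CARD('n)) > 1"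
    and short: "\<And>p q. supnorm (of_int_vec q) \<le> \<epsilon> * T \<Longrightarrow>
      supnorm (X *v of_int_vec q + of_int_vec p) \<le> \<epsilon> * s \<Longrightarrow> p = 0 \<and> q = 0"
    and N: "N \<ge> 1"
  obtains p q where "\<And>i. int N dvd p $ i - w $ i" "\<And>j. int N dvd q $ j - v $ j"
    "\<And>j. T \<le> real_of_int (q $ j)" "\<And>j. real_of_int (q $ j) \<le> real (2 * N * K + 1) * T"
    "supnorm (X *v of_int_vec q + of_int_vec p) \<le> real (2 * N * K + 1) * s"
proof -
  \<comment> \<open>The solution \<open>q\<close> found below is within \<open>N * K * T\<close> of
    \<open>y\<close> in each coordinate, which puts it between \<open>T\<close> and
    \<open>(2 * N * K + 1) * T\<close>.\<close>
  define y :: "real^'n" where "y = (\<chi> j. real (N * K + 1) * T)"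
  \<comment> \<open>Substituting \<open>p = w + N p'\<close> and \<open>q = v + N q'\<close> and
    dividing by \<open>N\<close> turns the congruences into an inhomogeneous problem for free
    integers \<open>p'\<close>, \<open>q'\<close>; the centre \<open>y\<close> for \<open>q\<close>
    must be compensated in the first component by \<open>X *v y\<close>.\<close>
  define \<alpha> where "\<alpha> = (1 / real N) *\<^sub>R (of_int_vec w + X *v y)"
  define \<beta> where "\<beta> = (1 / real N) *\<^sub>R (of_int_vec v - y)"
  obtain p' q' where pq': "supnorm (of_int_vec q' + \<beta>) \<le> real K * \<epsilon> * T"
    "supnorm (X *v (of_int_vec q' + \<beta>) + of_int_vec p' + \<alpha>) \<le> real K * \<epsilon> * s"
    by (rule inhomogeneous_solution[OF s T vol eps(1) K short, where \<alpha> = \<alpha> and \<beta> = \<beta>])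
  define p where "p = w + (\<chi> i. int N * p' $ i)"
  define q where "q = v + (\<chi> j. int N * q' $ j)"
  have rp: "of_int_vec p = of_int_vec w + real N *\<^sub>R of_int_vec p'"
    and rq: "of_int_vec q = of_int_vec v + real N *\<^sub>R of_int_vec q'"
    by (simp_all add: p_def q_def vec_eq_iff)
  have eq1: "of_int_vec q - y = real N *\<^sub>R (of_int_vec q' + \<beta>)"
    using N by (simp add: rq \<beta>_def scaleR_right_distrib)
  have eq2: "X *v of_int_vec q + of_int_vec p = real N *\<^sub>R (X *v (of_int_vec q' + \<beta>) + of_int_vec p'
    + \<alpha>)"
    (is "?l = _ *\<^sub>R ?r")
  proof -
    have "real N *\<^sub>R ?r = X *v (real N *\<^sub>R (of_int_vec q' + \<beta>)) + real N *\<^sub>R of_int_vec p'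
      + real N *\<^sub>R \<alpha>"
      by (subst matrix_vector_mult_scaleR) (simp add: scaleR_right_distrib)
    also have "\<dots> = X *v (of_int_vec q - y) + real N *\<^sub>R of_int_vec p' + (of_int_vec w + X *v y)"
      using N by (simp only: eq1 \<alpha>_def scaleR_scaleR) simp
    also have "\<dots> = ?l"
      by (simp add: rp matrix_vector_mult_diff_distrib)
    finally show ?thesis by simp
  qed
  have NKe: "real N * (real K * \<epsilon> * r) \<le> real N * real K * r" if "r > 0" for r
  proof -
    have "real N * real K * r * \<epsilon> \<le> real N * real K * r * 1"
      using that eps by (intro mult_left_mono) auto
    then show ?thesis by (simp add: algebra_simps)
  qed
  have "supnorm (of_int_vec q - y) \<le> real N * (real K * \<epsilon> * T)"
    unfolding eq1 supnorm_scaleR using pq'(1) by (simp add: mult_left_mono)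
  then have q: "\<bar>real_of_int (q $ j) - real (N * K + 1) * T\<bar> \<le> real N * real K * T" for j
    using NKe[OF T] abs_le_supnorm[of "of_int_vec q - y" j] by (simp add: y_def)
  have "supnorm (X *v of_int_vec q + of_int_vec p) \<le> real N * (real K * \<epsilon> * s)"
    unfolding eq2 supnorm_scaleR using pq'(2) by (simp add: mult_left_mono)
  also have "\<dots> \<le> real N * real K * s" by (rule NKe[OF s])
  also have "\<dots> \<le> real (2 * N * K + 1) * s"
    using s by (intro mult_right_mono) auto
  finally have p: "supnorm (X *v of_int_vec q + of_int_vec p) \<le> real (2 * N * K + 1) * s" .
  show ?thesis
  proof (rule that[OF _ _ _ _ p])
    show "int N dvd p $ i - w $ i" "int N dvd q $ j - v $ j" for i j
      by (simp_all add: p_def q_def)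
    show "T \<le> real_of_int (q $ j)" "real_of_int (q $ j) \<le> real (2 * N * K + 1) * T" for j
      using q[of j] by (simp_all add: abs_le_iff algebra_simps)
  qed
qed

section \<open>Counting integer vectors\<close>

lemma card_int_interval_le:
  fixes c h :: real
  assumes "h \<ge> 0"
  shows "finite {z :: int. \<bar>real_of_int z - c\<bar> \<le> h}" "real (card {z :: int. \<bar>real_of_int z - c\<bar>
    \<le> h}) \<le> 2 * h + 1"
proof -
  have eq: "{z :: int. \<bar>real_of_int z - c\<bar> \<le> h} = {\<lceil>c - h\<rceil>..\<lfloor>c + h\<rfloor>}"
    by (auto simp: abs_le_iff ceiling_le_iff le_floor_iff)
  then show "finite {z :: int. \<bar>real_of_int z - c\<bar> \<le> h}" by simp
  have "real_of_int (\<lfloor>c + h\<rfloor> - \<lceil>c - h\<rceil> + 1) \<le> 2 * h + 1"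
    by linarith
  then show "real (card {z :: int. \<bar>real_of_int z - c\<bar> \<le> h}) \<le> 2 * h + 1"
    unfolding eq using assms by simp
qed

lemma card_int_box_le:
  fixes c h :: "'k::finite \<Rightarrow> real"
  assumes "\<And>i. h i \<ge> 0"
  shows "finite {p :: int^'k. \<forall>i. \<bar>real_of_int (p $ i) - c i\<bar> \<le> h i}" (is "finite ?P")
    "real (card {p :: int^'k. \<forall>i. \<bar>real_of_int (p $ i) - c i\<bar> \<le> h i}) \<le> (\<Prod>i\<in>UNIV. 2 * h i + 1)"
proof -
  let ?A = "\<lambda>i. {z :: int. \<bar>real_of_int z - c i\<bar> \<le> h i}"
  have fin: "finite (PiE UNIV ?A)"
    using card_int_interval_le(1) assms by (intro finite_PiE) auto
  have inj: "inj_on vec_nth ?P" by (simp add: inj_on_def vec_nth_inject)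
  have sub: "vec_nth ` ?P \<subseteq> PiE UNIV ?A" by auto
  show "finite ?P"
    using finite_subset[OF sub fin] inj by (rule finite_imageD)
  have "card ?P \<le> card (PiE UNIV ?A)"
    by (rule card_inj_on_le[OF inj sub fin])
  also have "\<dots> = (\<Prod>i\<in>UNIV. card (?A i))"
    by (simp add: card_PiE)
  finally have "real (card ?P) \<le> (\<Prod>i\<in>UNIV. real (card (?A i)))"
    by (simp only: of_nat_prod[symmetric] of_nat_le_iff)
  also have "\<dots> \<le> (\<Prod>i\<in>UNIV. 2 * h i + 1)"
    using card_int_interval_le(2) assms by (intro prod_mono) auto
  finally show "real (card ?P) \<le> (\<Prod>i\<in>UNIV. 2 * h i + 1)" .
qed

lemma card_int_cube_le:
  assumes "H \<ge> 0"
  shows "finite {q :: int^'k. supnorm (of_int_vec q) \<le> H}"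
    "real (card {q :: int^'k. supnorm (of_int_vec q) \<le> H}) \<le> (2 * H + 1) ^ CARD('k)"
  using card_int_box_le[of "\<lambda>_ :: 'k. H" "\<lambda>_. 0"] assms by (simp_all add: supnorm_le_iff)

text \<open>A bound on one coordinate saves a factor of order \<open>H\<close> over the full cube.
  Used with \<open>L = 0\<close> for a vanishing coordinate and with \<open>L = 1 / R\<close> for a
  coordinate that is small relative to a ball of radius \<open>R\<close>.\<close>

lemma card_int_slab_le:
  assumes "H \<ge> 0" "L \<ge> 0"
  shows "real (card {q :: int^'k. supnorm (of_int_vec q) \<le> H \<and> \<bar>real_of_int (q $ j)\<bar> \<le> L})
    \<le> (2 * H + 1) ^ (CARD('k) - 1) * (2 * L + 1)"
proof -
  let ?h = "\<lambda>i. if i = j then L else H" and ?c = "\<lambda>_ :: 'k. 0 :: real"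
  have "{q :: int^'k. supnorm (of_int_vec q) \<le> H \<and> \<bar>real_of_int (q $ j)\<bar> \<le> L}
      \<subseteq> {q. \<forall>i. \<bar>real_of_int (q $ i) - ?c i\<bar> \<le> ?h i}"
    by (auto simp: supnorm_le_iff)
  then have "real (card {q :: int^'k. supnorm (of_int_vec q) \<le> H \<and> \<bar>real_of_int (q $ j)\<bar> \<le> L})
      \<le> real (card {q :: int^'k. \<forall>i. \<bar>real_of_int (q $ i) - ?c i\<bar> \<le> ?h i})"
    using card_int_box_le(1)[of ?h ?c] assms by (simp add: card_mono)
  also have "\<dots> \<le> (\<Prod>i\<in>UNIV. 2 * ?h i + 1)"
    using assms by (intro card_int_box_le(2)) auto
  also have "\<dots> = (2 * L + 1) * (\<Prod>i\<in>UNIV - {j}. 2 * ?h i + 1)"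
    by (subst prod.remove[of _ j]) auto
  also have "(\<Prod>i\<in>UNIV - {j}. 2 * ?h i + 1) = (\<Prod>i\<in>UNIV - {j}. 2 * H + 1)"
    by (intro prod.cong) auto
  also have "\<dots> = (2 * H + 1) ^ (CARD('k) - 1)"
    by simp
  finally show ?thesis by (simp add: mult.commute)
qed

text \<open>For fixed \<open>q\<close>, with \<open>a = q $ j\<close>, the points lie in cubes of
  half-width \<open>s / \<bar>a\<bar>\<close> around \<open>- (c q + p) / a\<close>. At most
  \<open>(2 * \<bar>a\<bar> * R + 2) ^ m\<close> of the \<open>p\<close> matter inside the ball, and
  this number times the volume of a cube is the summand.\<close>

lemma slice_measure:
  fixes c :: "int^'n \<Rightarrow> real^'m" and Q :: "(int^'n) set" and x0 :: "real^'m"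
  assumes Q: "finite Q" "\<And>q. q \<in> Q \<Longrightarrow> q $ j \<noteq> 0" and s: "0 \<le> s" "s \<le> 1/2" and R: "R > 0"
  defines "V \<equiv> {x \<in> ball x0 R. \<exists>q\<in>Q. \<exists>p. supnorm (c q + real_of_int (q $ j) *\<^sub>R x + of_int_vec p) \<le> s}"
  shows "V \<in> fmeasurable lborel"
    "measure lborel V \<le> (\<Sum>q\<in>Q. (4 * s * (R + 1 / \<bar>real_of_int (q $ j)\<bar>)) ^ CARD('m))"
proof -
  define a where "a q = real_of_int (q $ j)" for q :: "int^'n"
  have a: "\<bar>a q\<bar> > 0" if "q \<in> Q" for q
    using Q(2)[OF that] by (simp add: a_def)
  \<comment> \<open>The only \<open>p\<close> whose cube can meet the ball. Counting them gives
    \<open>2 * (\<bar>a q\<bar> * R + s) + 1\<close> per coordinate, and \<open>s \<le> 1/2\<close>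
    rounds this up to \<open>2 * \<bar>a q\<bar> * R + 2\<close>.\<close>
  define Pq where "Pq q = {p :: int^'m. \<forall>i. \<bar>real_of_int (p $ i) - (- (a q * x0 $ i + c q $ i))\<bar>
    \<le> \<bar>a q\<bar> * R + s}" for q
  define cube where "cube q p = {x :: real^'m. supnorm (x - (- (1 / a q) *\<^sub>R (c q + of_int_vec p)))
    \<le> s / \<bar>a q\<bar>}" for q p
  have cube_iff: "x \<in> cube q p \<longleftrightarrow> supnorm (c q + a q *\<^sub>R x + of_int_vec p) \<le> s" if "q \<in> Q" for x p q
  proof -
    have "c q + a q *\<^sub>R x + of_int_vec p = a q *\<^sub>R (x - (- (1 / a q) *\<^sub>R (c q + of_int_vec p)))"
      using a[OF that] by (simp add: algebra_simps scaleR_right_distrib)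
    then show ?thesis
      using a[OF that] by (simp add: cube_def supnorm_scaleR pos_le_divide_eq mult.commute)
  qed
  have cube_meas: "emeasure lborel (cube q p) = ennreal ((2 * s / \<bar>a q\<bar>) ^ CARD('m))" if "q \<in> Q" for q p
    unfolding cube_def by (subst emeasure_supnorm_le) (use s in simp_all)
  have cube_sets: "cube q p \<in> sets lborel" for q p
    unfolding cube_def supnorm_le_iff by measurable
  have cubef: "cube q p \<in> fmeasurable lborel" if "q \<in> Q" for q p
    using cube_meas[OF that] cube_sets by (auto simp: fmeasurable_def)
  have h: "0 \<le> \<bar>a q\<bar> * R + s" for q using R s by simp
  have Pfin: "finite (Pq q)" for q
    unfolding Pq_def using h by (intro card_int_box_le(1)) auto
  have Pcard: "real (card (Pq q)) \<le> (2 * \<bar>a q\<bar> * R + 2) ^ CARD('m)" for q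
  proof -
    have "real (card (Pq q)) \<le> (\<Prod>i\<in>(UNIV :: 'm set). 2 * (\<bar>a q\<bar> * R + s) + 1)"
      unfolding Pq_def using h by (intro card_int_box_le(2)) auto
    also have "\<dots> \<le> (\<Prod>i\<in>(UNIV :: 'm set). 2 * \<bar>a q\<bar> * R + 2)"
      using s h R by (intro prod_mono) auto
    finally show ?thesis by simp
  qed
  have sub: "V \<subseteq> (\<Union>z\<in>Sigma Q Pq. cube (fst z) (snd z))"
  proof
    fix x assume "x \<in> V"
    then obtain q p where x: "x \<in> ball x0 R" and q: "q \<in> Q"
      and le: "supnorm (c q + a q *\<^sub>R x + of_int_vec p) \<le> s"
      by (auto simp: V_def a_def)
    have "\<bar>real_of_int (p $ i) - (- (a q * x0 $ i + c q $ i))\<bar> \<le> \<bar>a q\<bar> * R + s" for i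
    proof -
      have "\<bar>(x0 - x) $ i\<bar> \<le> norm (x0 - x)" by (rule component_le_norm_cart)
      then have "\<bar>(x0 - x) $ i\<bar> \<le> R" using x by (simp add: dist_norm)
      then have 1: "\<bar>a q * ((x0 - x) $ i)\<bar> \<le> \<bar>a q\<bar> * R" by (simp add: abs_mult mult_left_mono)
      have 2: "\<bar>(c q + a q *\<^sub>R x + of_int_vec p) $ i\<bar> \<le> s"
        using order.trans[OF abs_le_supnorm le] .
      have "real_of_int (p $ i) - (- (a q * x0 $ i + c q $ i))
          = a q * ((x0 - x) $ i) + (c q + a q *\<^sub>R x + of_int_vec p) $ i"
        by (simp add: algebra_simps)
      then show ?thesis using 1 2 by linarith
    qed
    then have "p \<in> Pq q" by (simp add: Pq_def)
    then show "x \<in> (\<Union>z\<in>Sigma Q Pq. cube (fst z) (snd z))"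
      using q le cube_iff[OF q] by force
  qed
  have "V = {x \<in> ball x0 R. \<exists>q\<in>Q. \<exists>p. x \<in> cube q p}"
    unfolding V_def a_def[symmetric] by (intro Collect_cong conj_cong bex_cong refl) (simp add: cube_iff)
  then have "V = ball x0 R \<inter> (\<Union>q\<in>Q. \<Union>p. cube q p)"
    by blast
  moreover have "(\<Union>q\<in>Q. \<Union>p. cube q p) \<in> sets lborel"
    using Q(1) cube_sets by (intro sets.finite_UN sets.countable_UN') auto
  ultimately have V: "V \<in> sets lborel" by auto
  have ballf: "ball x0 R \<in> fmeasurable lborel"
    using emeasure_bounded_finite[OF bounded_ball] by (auto simp: fmeasurable_def)
  show "V \<in> fmeasurable lborel"
    by (rule fmeasurableI2[OF ballf _ V]) (auto simp: V_def)
  have fin: "finite (Sigma Q Pq)" using Q(1) Pfin by auto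
  have "measure lborel V \<le> measure lborel (\<Union>z\<in>Sigma Q Pq. cube (fst z) (snd z))"
    using sub V fin cubef by (intro measure_mono_fmeasurable fmeasurable.finite_UN) auto
  also have "\<dots> \<le> (\<Sum>z\<in>Sigma Q Pq. measure lborel (cube (fst z) (snd z)))"
    using fin cube_sets by (intro measure_UNION_le) auto
  also have "\<dots> = (\<Sum>q\<in>Q. \<Sum>p\<in>Pq q. measure lborel (cube q p))"
    using Q(1) Pfin by (subst sum.Sigma) (auto simp: case_prod_beta)
  also have "\<dots> = (\<Sum>q\<in>Q. real (card (Pq q)) * (2 * s / \<bar>a q\<bar>) ^ CARD('m))"
    using s by (intro sum.cong) (auto simp: measure_def cube_meas)
  also have "\<dots> \<le> (\<Sum>q\<in>Q. (2 * \<bar>a q\<bar> * R + 2) ^ CARD('m) * (2 * s / \<bar>a q\<bar>) ^ CARD('m))"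
    using s Pcard by (intro sum_mono mult_right_mono) auto
  also have "\<dots> = (\<Sum>q\<in>Q. (4 * s * (R + 1 / \<bar>a q\<bar>)) ^ CARD('m))"
  proof (intro sum.cong refl)
    fix q assume "q \<in> Q"
    have "(2 * \<bar>a q\<bar> * R + 2) * (2 * s / \<bar>a q\<bar>) = 4 * s * (R + 1 / \<bar>a q\<bar>)"
      using a[OF \<open>q \<in> Q\<close>] by (simp add: field_simps)
    then show "(2 * \<bar>a q\<bar> * R + 2) ^ CARD('m) * (2 * s / \<bar>a q\<bar>) ^ CARD('m) = (4 * s * (R
      + 1 / \<bar>a q\<bar>)) ^ CARD('m)"
      by (simp only: power_mult_distrib[symmetric])
  qed
  finally show "measure lborel V \<le> (\<Sum>q\<in>Q. (4 * s * (R + 1 / \<bar>real_of_int (q $ j)\<bar>)) ^ CARD('m))"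
    by (simp add: a_def)
qed

section \<open>Scales without short vectors\<close>

text \<open>Columns are varied by adding this matrix to a full \<open>\<theta>\<close>, which avoids
  splitting the matrix space into one column and the rest.\<close>

definition column_matrix :: "'n \<Rightarrow> real^'m \<Rightarrow> real^'n^'m" where
  "column_matrix j x = (\<chi> i k. if k = j then x $ i else 0)"

lemma add_column_matrix_mult:
  "(\<theta> + column_matrix j x) *v z = \<theta> *v z + z $ j *\<^sub>R x" for \<theta> :: "real^'n^'m"
proof -
  have "(\<Sum>k\<in>UNIV. (if k = j then x $ i else 0) * z $ k) = z $ j * x $ i" for i
  proof -
    have "(\<Sum>k\<in>UNIV. (if k = j then x $ i else 0) * z $ k) = (\<Sum>k\<in>UNIV. if k
      = j then x $ i * z $ k else 0)"
      by (intro sum.cong) auto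
    then show ?thesis by simp
  qed
  then show ?thesis
    by (simp add: column_matrix_def vec_eq_iff matrix_vector_mult_def distrib_right sum.distrib)
qed

lemma continuous_on_column_matrix [continuous_intros]:
  assumes "continuous_on A f"
  shows "continuous_on A (\<lambda>x. column_matrix j (f x))"
proof -
  have "continuous_on A (\<lambda>x. if k = j then f x $ i else 0)" for i k
    using assms by (cases "k = j") (auto intro!: continuous_intros)
  then show ?thesis unfolding column_matrix_def by (intro continuous_on_vec_lambda)
qed

text \<open>Fubini on pairs \<open>(\<theta>, x)\<close> exchanges the quantifiers, so some single
  \<open>x\<close> works for almost all \<open>\<theta>\<close>, since otherwise the whole column
  space would be null. Translating by \<open>column_matrix j x\<close> preserves Lebesgue measure
  and removes this \<open>x\<close>.\<close>

lemma AE_if_AE_column: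
  fixes P :: "real^'n^'m \<Rightarrow> bool" and j :: 'n
  assumes P: "{\<theta>. P \<theta>} \<in> sets borel"
    and ae: "AE \<theta> in lborel. AE x in lborel. P (\<theta> + column_matrix j x)"
  shows "AE \<theta> in lborel. P \<theta>"
proof -
  have "(\<lambda>z. fst z + column_matrix j (snd z)) \<in> borel_measurable (borel :: ((real^'n^'m) \<times>
    (real^'m)) measure)"
    by (intro borel_measurable_continuous_onI continuous_intros)
  from measurable_sets[OF this P]
  have "{z. P (fst z + column_matrix j (snd z))} \<in> sets (borel :: ((real^'n^'m) \<times> (real^'m)) measure)"
    by (simp add: vimage_def)
  then have S: "{z \<in> space (lborel \<Otimes>\<^sub>M lborel). P (fst z + column_matrix j (snd z))}
      \<in> sets (lborel \<Otimes>\<^sub>M lborel)"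
    unfolding lborel_prod by simp
  have ae': "AE x in lborel. AE \<theta> in lborel. P (\<theta> + column_matrix j x)"
    using lborel_pair.AE_commute[of "\<lambda>\<theta> x. P (\<theta> + column_matrix j x)", OF S] ae by blast
  have "\<exists>x. AE \<theta> in lborel. P (\<theta> + column_matrix j x)"
  proof (rule ccontr)
    assume "\<not> ?thesis"
    then have "AE x in (lborel :: (real^'m) measure). False" using ae' by (auto elim: AE_mp)
    then have "(UNIV :: (real^'m) set) \<in> null_sets lborel"
      by (auto simp: eventually_ae_filter UNIV_eq_I top.extremum_unique)
    then show False by (simp add: null_sets_def)
  qed
  then obtain x where "AE \<theta> in lborel. P (column_matrix j x + \<theta>)"
    by (auto simp: add.commute)
  then have "AE \<theta> in distr lborel borel ((+) (column_matrix j x)). P \<theta>"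
    using P by (subst AE_distr_iff) auto
  moreover have "distr lborel borel ((+) (column_matrix j x)) = lborel"
    by (rule lborel_distr_plus)
  ultimately show ?thesis by metis
qed

lemma borel_measurable_mult_vector [measurable]:
  "(\<lambda>\<theta> :: real^'n^'m. \<theta> *v z) \<in> borel_measurable borel"
  unfolding matrix_vector_mult_def
  by (intro borel_measurable_continuous_onI continuous_on_vec_lambda continuous_intros)

text \<open>When one coordinate of \<open>q\<close> is lost, about \<open>t ^ (m * (n - 1))\<close>
  vectors remain, each contributing volume about \<open>t ^ (- n * m)\<close>. The surplus
  \<open>1 / t ^ m\<close> makes these contributions decay geometrically along
  \<open>t = M ^ k\<close>.\<close>

lemma scale_powers:
  fixes t :: real
  assumes "t > 0" "n > 0"
  shows "(t ^ m) ^ (n - 1) * (1 / t ^ n) ^ m = 1 / t ^ m"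
proof -
  obtain n' where "n = Suc n'" using assms(2) by (cases n) auto
  moreover have "(t ^ n') ^ m = (t ^ m) ^ n'" by (simp add: power_mult[symmetric] mult.commute)
  ultimately show ?thesis using assms(1) by (simp add: power_divide power_mult_distrib)
qed

text \<open>A nonzero \<open>q\<close> with \<open>q $ j0 = 0\<close> has another nonzero coordinate
  \<open>j\<close>. In the column \<open>j\<close>, the points with such a short vector at scale
  \<open>k\<close> have measure of order \<open>M ^ (- k)\<close> in each bounded region, because
  the vanishing coordinate thins out the \<open>q\<close>; Borel-Cantelli applies.\<close>

lemma AE_no_short_vector_in_slab:
  fixes M :: nat and j0 :: "'n::finite"
  assumes M: "M \<ge> 2" and eps: "0 < \<epsilon>" "\<epsilon> \<le> 1/2"
  shows "AE \<theta> in (lborel :: (real^'n^'m) measure). \<forall>\<^sub>F k in sequentially. \<forall>p q. q \<noteq> 0 \<longrightarrow> q $ j0 = 0 \<longrightarrow>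
    supnorm (of_int_vec q) \<le> \<epsilon> * (real M ^ k) ^ CARD('m) \<longrightarrow>
    \<not> supnorm (\<theta> *v of_int_vec q + of_int_vec p) \<le> \<epsilon> / (real M ^ k) ^ CARD('n)"
proof -
  define T where "T k = (real M ^ k) ^ CARD('m)" for k
  define s where "s k = \<epsilon> / (real M ^ k) ^ CARD('n)" for k
  \<comment> \<open>Sorted by the nonzero coordinate \<open>j\<close>, since each \<open>j\<close>
    needs its own column as variable. The case \<open>j = j0\<close> is vacuous, and there are
    finitely many \<open>j\<close> to combine.\<close>
  define P where "P j \<theta> \<longleftrightarrow> (\<forall>\<^sub>F k in sequentially. \<forall>p q. q $ j \<noteq> 0 \<longrightarrow> q $ j0 = 0 \<longrightarrow>
    supnorm (of_int_vec q) \<le> \<epsilon> * T k \<longrightarrow> \<not> supnorm (\<theta> *v of_int_vec q + of_int_vec p) \<le> s k)"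
    for j and \<theta> :: "real^'n^'m"
  have T1: "1 \<le> T k" for k using M by (simp add: T_def one_le_power)
  have t1: "1 \<le> real M ^ k" for k using M by (simp add: one_le_power)
  have s_pos: "0 < s k" for k using M eps by (simp add: s_def)
  have s_half: "s k \<le> 1/2" for k
  proof -
    have "\<epsilon> \<le> 1/2 * (real M ^ k) ^ CARD('n)"
      using eps mult_left_mono[OF one_le_power[OF t1[of k]], of "1/2" "CARD('n)"] by simp
    then show ?thesis using M by (simp add: s_def divide_le_eq)
  qed
  have "AE \<theta> in lborel. P j \<theta>" for j
  proof (rule AE_if_AE_column[where j = j], goal_cases)
    case 1
    show ?case
      unfolding P_def eventually_sequentially supnorm_le_iff[of "_ + _"] by measurable
  next
    case 2
    have "AE x in lborel. P j (\<theta> + column_matrix j x)" for \<theta> :: "real^'n^'m"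
    proof -
      define Q where "Q k = {q. q $ j \<noteq> 0 \<and> q $ j0 = 0 \<and> supnorm (of_int_vec q) \<le> \<epsilon> * T k}" for k
      \<comment> \<open>Restricting to balls makes the measures finite; countably many
        \<open>r\<close> exhaust the space. The added \<open>1\<close> keeps the radius positive for
        \<open>r = 0\<close>.\<close>
      define V where "V r k = {x \<in> ball 0 (real r + 1). \<exists>q\<in>Q k. \<exists>p. supnorm (\<theta> *v of_int_vec q
          + real_of_int (q $ j) *\<^sub>R x + of_int_vec p) \<le> s k}" for r k
      have eT: "0 \<le> \<epsilon> * T k" for k using eps T1[of k] by simp
      have Qfin: "finite (Q k)" for k
        by (rule finite_subset[OF _ card_int_cube_le(1)[OF eT[of k]]]) (auto simp: Q_def)
      have Qcard: "real (card (Q k)) \<le> (3 * T k) ^ (CARD('n) - 1)" for k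
      proof -
        have "card (Q k) \<le> card {q :: int^'n. supnorm (of_int_vec q) \<le> \<epsilon> * T k
          \<and> \<bar>real_of_int (q $ j0)\<bar> \<le> 0}"
          by (rule card_mono, rule finite_subset[OF _ card_int_cube_le(1)[OF eT[of k]]])
            (auto simp: Q_def)
        also have "real \<dots> \<le> (2 * (\<epsilon> * T k) + 1) ^ (CARD('n) - 1)"
          using card_int_slab_le[OF eT[of k], of 0 j0] by simp
        also have "\<dots> \<le> (3 * T k) ^ (CARD('n) - 1)"
        proof (rule power_mono)
          have "\<epsilon> * T k \<le> 1 * T k" using eps T1[of k] by (intro mult_right_mono) auto
          then show "2 * (\<epsilon> * T k) + 1 \<le> 3 * T k" using T1[of k] by linarith
        qed (use eT[of k] in simp)
        finally show ?thesis by simp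
      qed
      have Vf: "V r k \<in> fmeasurable lborel"
        and Vle: "measure lborel (V r k) \<le> (\<Sum>q\<in>Q k. (4 * s k * (real r + 1
          + 1 / \<bar>real_of_int (q $ j)\<bar>)) ^ CARD('m))"
        for r k
        unfolding V_def using Qfin s_pos[of k] s_half[of k]
        by (intro slice_measure; auto simp: Q_def)+
      define C where "C r = 3 ^ (CARD('n) - 1) * (4 * \<epsilon> * (real r + 2)) ^ CARD('m)" for r
      have Vbound: "measure lborel (V r k) \<le> C r * (1 / real M) ^ k" for r k
      proof -
        have "measure lborel (V r k) \<le> (\<Sum>q\<in>Q k. (4 * s k * (real r + 2)) ^ CARD('m))"
        proof (rule order.trans[OF Vle sum_mono])
          fix q assume "q \<in> Q k"
          then have "1 \<le> \<bar>real_of_int (q $ j)\<bar>" by (auto simp: Q_def)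
          then have "1 / \<bar>real_of_int (q $ j)\<bar> \<le> 1" by (simp add: divide_le_eq)
          then show "(4 * s k * (real r + 1 + 1 / \<bar>real_of_int (q $ j)\<bar>)) ^ CARD('m)
            \<le> (4 * s k * (real r + 2)) ^ CARD('m)"
            using s_pos[of k] by (intro power_mono mult_left_mono) auto
        qed
        also have "\<dots> \<le> (3 * T k) ^ (CARD('n) - 1) * (4 * s k * (real r + 2)) ^ CARD('m)"
          using Qcard[of k] s_pos[of k] by (simp add: mult_right_mono)
        also have "\<dots> = C r * ((T k) ^ (CARD('n) - 1) * (1 / (real M ^ k) ^ CARD('n)) ^ CARD('m))"
          by (simp add: C_def s_def power_mult_distrib power_divide)
        also have "\<dots> = C r * (1 / (real M ^ k) ^ CARD('m))"
          using M unfolding T_def by (subst scale_powers) auto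
        also have "\<dots> \<le> C r * (1 / (real M ^ k) ^ 1)"
          using M eps t1[of k] unfolding C_def
          by (intro mult_left_mono divide_left_mono power_increasing) (auto simp: Suc_le_eq)
        finally show ?thesis by (simp add: power_divide)
      qed
      have "AE x in lborel. \<forall>\<^sub>F k in sequentially. x \<in> space lborel - V r k" for r
      proof (rule borel_cantelli_AE1)
        show "V r k \<in> sets lborel" "emeasure lborel (V r k) < \<infinity>" for k
          using Vf[of r k] by (auto simp: fmeasurable_def)
        have "summable (\<lambda>k. C r * (1 / real M) ^ k)"
          using M by (intro summable_mult summable_geometric) simp
        then show "summable (\<lambda>k. measure lborel (V r k))"
          by (rule summable_comparison_test'[where N = 0]) (simp add: Vbound)
      qed
      then have "AE x in lborel. \<forall>r. \<forall>\<^sub>F k in sequentially. x \<notin> V r k"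
        by (simp add: AE_all_countable)
      then show ?thesis
      proof (rule AE_mp, intro AE_I2 impI)
        fix x assume x: "\<forall>r. \<forall>\<^sub>F k in sequentially. x \<notin> V r k"
        obtain r where "norm x < real r" using reals_Archimedean2 by blast
        then have "x \<in> ball 0 (real r + 1)" by simp
        moreover have "\<forall>\<^sub>F k in sequentially. x \<notin> V r k" using x by blast
        ultimately show "P j (\<theta> + column_matrix j x)"
          unfolding P_def by (auto simp: V_def Q_def add_column_matrix_mult elim!: eventually_mono)
      qed
    qed
    then show ?case by simp
  qed
  then have "AE \<theta> in lborel. \<forall>j. P j \<theta>"
    by (simp add: AE_all_countable)
  then show ?thesis
  proof (rule AE_mp, intro AE_I2 impI)
    fix \<theta> :: "real^'n^'m" assume "\<forall>j. P j \<theta>"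
    then have "\<forall>\<^sub>F k in sequentially. \<forall>j. \<forall>p q. q $ j \<noteq> 0 \<longrightarrow> q $ j0 = 0 \<longrightarrow>
      supnorm (of_int_vec q) \<le> \<epsilon> * T k \<longrightarrow> \<not> supnorm (\<theta> *v of_int_vec q + of_int_vec p) \<le> s k"
      unfolding P_def by (intro eventually_all_finite) blast
    then show "\<forall>\<^sub>F k in sequentially. \<forall>p q. q \<noteq> 0 \<longrightarrow> q $ j0 = 0 \<longrightarrow>
      supnorm (of_int_vec q) \<le> \<epsilon> * (real M ^ k) ^ CARD('m) \<longrightarrow>
      \<not> supnorm (\<theta> *v of_int_vec q + of_int_vec p) \<le> \<epsilon> / (real M ^ k) ^ CARD('n)"
      by (rule eventually_mono) (auto simp: T_def s_def vec_eq_iff)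
  qed
qed

lemma eventually_geometric_le:
  fixes M :: nat and b C :: real
  assumes "M \<ge> 2" "b > 0"
  shows "\<forall>\<^sub>F k in sequentially. C * (1 / real M) ^ k \<le> b"
proof -
  have "(\<lambda>k. C * (1 / real M) ^ k) \<longlonglongrightarrow> 0"
    using assms(1) by (intro tendsto_mult_right_zero LIMSEQ_power_zero) simp
  then have "\<forall>\<^sub>F k in sequentially. C * (1 / real M) ^ k < b"
    using assms(2) by (rule order_tendstoD(2))
  then show ?thesis by (rule eventually_mono) simp
qed

text \<open>If \<open>q $ j0\<close> exceeds \<open>1 / R\<close> in absolute value, the volume
  attached to \<open>q\<close> is proportional to that of the ball; summed over all such
  \<open>q\<close>, the powers of the scale cancel and \<open>small\<close> leaves a quarter of the
  ball. The remaining \<open>q\<close> lie in a slab of fixed width, and their total decays like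
  \<open>M ^ (- k)\<close>, so it is eventually below another quarter.\<close>

lemma eventually_few_bad_points:
  fixes \<theta> :: "real^'n^'m" and j0 :: 'n and M :: nat and x0 :: "real^'m"
  assumes M: "M \<ge> 2" and eps: "0 < \<epsilon>" "\<epsilon> \<le> 1/2" and R: "R > 0"
    and small: "3 ^ CARD('n) * 8 ^ CARD('m) * \<epsilon> ^ (CARD('m) + CARD('n))
      \<le> unit_ball_vol (real CARD('m)) / 4"
  defines "V k \<equiv> {x \<in> ball x0 R. \<exists>q\<in>{q. q $ j0 \<noteq> 0 \<and> supnorm (of_int_vec q)
    \<le> \<epsilon> * (real M ^ k) ^ CARD('m)}. \<exists>p.
      supnorm (\<theta> *v of_int_vec q + real_of_int (q $ j0) *\<^sub>R x + of_int_vec p)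
        \<le> \<epsilon> / (real M ^ k) ^ CARD('n)}"
  shows "\<forall>\<^sub>F k in sequentially. V k \<in> fmeasurable lborel \<and> measure lborel (V k)
    \<le> measure lborel (ball x0 R) / 2"
proof -
  let ?m = "CARD('m)" and ?n = "CARD('n)"
  let ?v = "unit_ball_vol (real ?m)"
  define C where "C = (3 * \<epsilon>) ^ (?n - 1) * (2 / R + 1) * (4 * \<epsilon> * (R + 1)) ^ ?m"
  have "?v * R ^ ?m / 4 > 0" using R by simp
  \<comment> \<open>The first condition gives \<open>1 \<le> H\<close>, so that counts
    \<open>2 * H + 1\<close> can be replaced by \<open>3 * H\<close>; the second bounds the
    contribution of the slab \<open>Q'\<close>.\<close>
  then have "\<forall>\<^sub>F k in sequentially. 1 * (1 / real M) ^ k \<le> \<epsilon> \<and> C * (1 / real M) ^ k \<le> ?v * R ^ ?m / 4"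
    using M eps by (intro eventually_conj eventually_geometric_le) auto
  then show ?thesis
  proof (rule eventually_mono)
    fix k assume k: "1 * (1 / real M) ^ k \<le> \<epsilon> \<and> C * (1 / real M) ^ k \<le> ?v * R ^ ?m / 4"
    define t where "t = real M ^ k"
    define s where "s = \<epsilon> / t ^ ?n"
    define H where "H = \<epsilon> * t ^ ?m"
    have t1: "1 \<le> t" using M by (simp add: t_def one_le_power)
    have s_pos: "0 < s" using t1 eps by (simp add: s_def)
    have s_half: "s \<le> 1/2"
    proof -
      have "\<epsilon> \<le> 1/2 * t ^ ?n"
        using eps mult_left_mono[OF one_le_power[OF t1], of "1/2" ?n] by simp
      then show ?thesis using t1 by (simp add: s_def divide_le_eq)
    qed
    have tm: "t \<le> t ^ ?m"
      using power_increasing[OF _ t1, of 1 ?m] by (simp add: Suc_le_eq)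
    have H1: "1 \<le> H"
    proof -
      have "1 / t \<le> \<epsilon>"
        using conjunct1[OF k] by (simp add: t_def power_divide del: divide_le_eq_1)
      then have "1 \<le> \<epsilon> * t" using t1 by (simp add: pos_divide_le_eq)
      also have "\<dots> \<le> H" unfolding H_def using tm eps by (intro mult_left_mono) auto
      finally show ?thesis .
    qed
    define Q where "Q = {q :: int^'n. q $ j0 \<noteq> 0 \<and> supnorm (of_int_vec q) \<le> H}"
    define Q' where "Q' = {q \<in> Q. \<bar>real_of_int (q $ j0)\<bar> \<le> 1 / R}"
    have Qfin: "finite Q"
      using H1 by (intro finite_subset[OF _ card_int_cube_le(1)[of H]]) (auto simp: Q_def)
    have "card Q \<le> card {q :: int^'n. supnorm (of_int_vec q) \<le> H}"
      using H1 by (intro card_mono card_int_cube_le(1)) (auto simp: Q_def)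
    also have "real \<dots> \<le> (2 * H + 1) ^ ?n"
      using H1 by (intro card_int_cube_le(2)) auto
    also have "\<dots> \<le> (3 * H) ^ ?n"
      using H1 by (intro power_mono) auto
    finally have Qcard: "real (card Q) \<le> (3 * H) ^ ?n" by simp
    have "card Q' \<le> card {q :: int^'n. supnorm (of_int_vec q) \<le> H \<and> \<bar>real_of_int (q $ j0)\<bar> \<le> 1 / R}"
      using H1 by (intro card_mono finite_subset[OF _ card_int_cube_le(1)[of H]])
        (auto simp: Q_def Q'_def)
    also have "real \<dots> \<le> (2 * H + 1) ^ (?n - 1) * (2 * (1 / R) + 1)"
      using H1 R by (intro card_int_slab_le) auto
    also have "\<dots> \<le> (3 * H) ^ (?n - 1) * (2 / R + 1)"
      using H1 R by (intro mult_mono power_mono) auto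
    finally have Qcard': "real (card Q') \<le> (3 * H) ^ (?n - 1) * (2 / R + 1)" by simp
    have V_eq: "V k = {x \<in> ball x0 R. \<exists>q\<in>Q. \<exists>p. supnorm (\<theta> *v of_int_vec q
      + real_of_int (q $ j0) *\<^sub>R x + of_int_vec p) \<le> s}"
      by (simp add: V_def Q_def H_def s_def t_def)
    have Q0: "q $ j0 \<noteq> 0" if "q \<in> Q" for q using that by (simp add: Q_def)
    have Vf: "V k \<in> fmeasurable lborel"
      and Vle: "measure lborel (V k) \<le> (\<Sum>q\<in>Q. (4 * s * (R + 1 / \<bar>real_of_int (q $ j0)\<bar>)) ^ ?m)"
      unfolding V_eq using Qfin Q0 s_pos s_half R by (intro slice_measure; simp)+
    have summand: "(4 * s * (R + 1 / \<bar>real_of_int (q $ j0)\<bar>)) ^ ?m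
        \<le> (8 * s * R) ^ ?m + (if q \<in> Q' then (4 * s * (R + 1)) ^ ?m else 0)" if q: "q \<in> Q" for q
    proof -
      have a: "1 \<le> \<bar>real_of_int (q $ j0)\<bar>" using Q0[OF q] by simp
      have pos: "0 \<le> 8 * s * R" using s_pos R by simp
      show ?thesis
      proof (cases "q \<in> Q'")
        case True
        have "(4 * s * (R + 1 / \<bar>real_of_int (q $ j0)\<bar>)) ^ ?m \<le> (4 * s * (R + 1)) ^ ?m"
          using a s_pos R by (intro power_mono mult_left_mono) (auto simp: divide_le_eq)
        then show ?thesis using True pos by (simp add: add_increasing)
      next
        case False
        then have "1 / R < \<bar>real_of_int (q $ j0)\<bar>" using q by (simp add: Q'_def)
        then have "1 / \<bar>real_of_int (q $ j0)\<bar> \<le> R"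
          using R a by (simp add: field_simps)
        then have "4 * s * (R + 1 / \<bar>real_of_int (q $ j0)\<bar>) \<le> 4 * s * (R + R)"
          using s_pos by (intro mult_left_mono) auto
        then have "(4 * s * (R + 1 / \<bar>real_of_int (q $ j0)\<bar>)) ^ ?m \<le> (8 * s * R) ^ ?m"
          using s_pos R by (intro power_mono) auto
        then show ?thesis using False by simp
      qed
    qed
    have first: "(3 * H) ^ ?n * (8 * s * R) ^ ?m = 3 ^ ?n * 8 ^ ?m * \<epsilon> ^ (?m + ?n) * R ^ ?m"
    proof -
      have "(t ^ ?m) ^ ?n * (1 / t ^ ?n) ^ ?m = 1"
        using t1 by (simp add: power_divide power_mult[symmetric] mult.commute)
      moreover have "(3 * H) ^ ?n * (8 * s * R) ^ ?m
          = 3 ^ ?n * 8 ^ ?m * \<epsilon> ^ (?m + ?n) * R ^ ?m * ((t ^ ?m) ^ ?n * (1 / t ^ ?n) ^ ?m)"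
        by (simp add: H_def s_def power_mult_distrib power_divide power_add)
      ultimately show ?thesis by simp
    qed
    have second: "(3 * H) ^ (?n - 1) * (2 / R + 1) * (4 * s * (R + 1)) ^ ?m \<le> C * (1 / real M) ^ k"
    proof -
      have "(3 * H) ^ (?n - 1) * (2 / R + 1) * (4 * s * (R + 1)) ^ ?m
          = C * ((t ^ ?m) ^ (?n - 1) * (1 / t ^ ?n) ^ ?m)"
        by (simp add: C_def H_def s_def power_mult_distrib power_divide)
      also have "\<dots> = C * (1 / t ^ ?m)"
        using t1 by (subst scale_powers) auto
      also have "\<dots> \<le> C * (1 / t)"
        using tm t1 eps R unfolding C_def by (intro mult_left_mono divide_left_mono) auto
      finally show ?thesis by (simp add: t_def power_divide)
    qed
    have "measure lborel (V k) \<le> (\<Sum>q\<in>Q. (8 * s * R) ^ ?m + (if q \<in> Q' then (4 * s * (R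
      + 1)) ^ ?m else 0))"
      by (rule order.trans[OF Vle sum_mono[OF summand]])
    also have "\<dots> = real (card Q) * (8 * s * R) ^ ?m + (\<Sum>q\<in>Q. if q \<in> Q' then (4 * s * (R
      + 1)) ^ ?m else 0)"
      by (simp add: sum.distrib)
    also have "(\<Sum>q\<in>Q. if q \<in> Q' then (4 * s * (R + 1)) ^ ?m else 0) = real (card Q') * (4 * s * (R
      + 1)) ^ ?m"
    proof -
      have "Q \<inter> Q' = Q'" by (auto simp: Q'_def)
      then show ?thesis using Qfin by (simp add: sum.inter_restrict[symmetric])
    qed
    also have "real (card Q) * (8 * s * R) ^ ?m + real (card Q') * (4 * s * (R + 1)) ^ ?m
        \<le> (3 * H) ^ ?n * (8 * s * R) ^ ?m + (3 * H) ^ (?n - 1) * (2 / R + 1) * (4 * s * (R + 1)) ^ ?m"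
      using Qcard Qcard' s_pos R by (intro add_mono mult_right_mono) auto
    also have "\<dots> \<le> 3 ^ ?n * 8 ^ ?m * \<epsilon> ^ (?m + ?n) * R ^ ?m + C * (1 / real M) ^ k"
      unfolding first using second by (rule add_left_mono)
    also have "\<dots> \<le> ?v / 4 * R ^ ?m + ?v * R ^ ?m / 4"
      using small k R by (intro add_mono mult_right_mono) auto
    also have "\<dots> = measure lborel (ball x0 R) / 2"
      using R by (simp add: content_ball)
    finally show "V k \<in> fmeasurable lborel \<and> measure lborel (V k) \<le> measure lborel (ball x0 R) / 2"
      using Vf by simp
  qed
qed

text \<open>For \<open>x\<close> outside \<open>Bad\<close>, the matrix
  \<open>\<theta> + column_matrix j0 x\<close> has no short integer vector:
  \<open>q $ j0 \<noteq> 0\<close> is excluded by \<open>Bad\<close>, a nonzero \<open>q\<close>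
  with \<open>q $ j0 = 0\<close> by \<open>generic\<close>, and \<open>q = 0\<close> leaves a
  \<open>p\<close> of norm below \<open>1\<close>. So \<open>congruent_solution\<close>
  applies.\<close>

lemma eventually_congruent_solutions:
  fixes \<theta> :: "real^'n^'m" and j0 :: 'n and w :: "int^'m" and v :: "int^'n" and M N K :: nat
  assumes M: "M \<ge> 2" and N: "N \<ge> 1" and eps: "0 < \<epsilon>" "\<epsilon> \<le> 1/2" and R: "R > 0"
    and small: "3 ^ CARD('n) * 8 ^ CARD('m) * \<epsilon> ^ (CARD('m) + CARD('n))
      \<le> unit_ball_vol (real CARD('m)) / 4"
    and K: "real K * \<epsilon> ^ (CARD('m) + CARD('n)) > 1"
    and generic: "\<forall>\<^sub>F k in sequentially. \<forall>p q. q \<noteq> 0 \<longrightarrow> q $ j0 = 0 \<longrightarrow>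
      supnorm (of_int_vec q) \<le> \<epsilon> * (real M ^ k) ^ CARD('m) \<longrightarrow>
      \<not> supnorm (\<theta> *v of_int_vec q + of_int_vec p) \<le> \<epsilon> / (real M ^ k) ^ CARD('n)"
  shows "\<forall>\<^sub>F k in sequentially. \<exists>Bad. Bad \<in> fmeasurable lborel \<and>
    measure lborel Bad \<le> measure lborel (ball x0 R) / 2 \<and>
    (\<forall>x\<in>ball x0 R - Bad. \<exists>p q. (\<forall>i. int N dvd p $ i - w $ i) \<and> (\<forall>j. int N dvd q $ j - v $ j) \<and>
      (\<forall>j. (real M ^ k) ^ CARD('m) \<le> real_of_int (q $ j) \<and>
        real_of_int (q $ j) \<le> real (2 * N * K + 1) * (real M ^ k) ^ CARD('m)) \<and>
      supnorm (\<theta> *v of_int_vec q + real_of_int (q $ j0) *\<^sub>R x + of_int_vec p)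
        \<le> real (2 * N * K + 1) * (1 / (real M ^ k) ^ CARD('n)))"
  using generic eventually_few_bad_points[OF M eps R small, of x0 j0 \<theta>]
proof eventually_elim
  case (elim k)
  let ?m = "CARD('m)" and ?n = "CARD('n)"
  define t where "t = real M ^ k"
  define Bad where "Bad = {x \<in> ball x0 R. \<exists>q\<in>{q. q $ j0 \<noteq> 0 \<and> supnorm (of_int_vec q) \<le> \<epsilon> * t ^ ?m}. \<exists>p.
      supnorm (\<theta> *v of_int_vec q + real_of_int (q $ j0) *\<^sub>R x + of_int_vec p) \<le> \<epsilon> / t ^ ?n}"
  have t1: "1 \<le> t" using M by (simp add: t_def one_le_power)
  have sol: "\<exists>p q. (\<forall>i. int N dvd p $ i - w $ i) \<and> (\<forall>j. int N dvd q $ j - v $ j) \<and>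
      (\<forall>j. t ^ ?m \<le> real_of_int (q $ j) \<and> real_of_int (q $ j) \<le> real (2 * N * K + 1) * t ^ ?m) \<and>
      supnorm (\<theta> *v of_int_vec q + real_of_int (q $ j0) *\<^sub>R x + of_int_vec p) \<le> real (2 * N * K
        + 1) * (1 / t ^ ?n)"
    if x: "x \<in> ball x0 R - Bad" for x
  proof -
    \<comment> \<open>Scales of the form \<open>T = t ^ m\<close> and \<open>s = 1 / t ^ n\<close>
      satisfy the volume condition without any roots.\<close>
    have vol: "(1 / t ^ ?n) ^ ?m * (t ^ ?m) ^ ?n = 1"
      using t1 by (simp add: power_divide power_mult[symmetric] mult.commute)
    have short: "p = 0 \<and> q = 0" if q: "supnorm (of_int_vec q) \<le> \<epsilon> * t ^ ?m"
      and "supnorm ((\<theta> + column_matrix j0 x) *v of_int_vec q + of_int_vec p) \<le> \<epsilon> * (1 / t ^ ?n)" for p q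
    proof -
      have p: "supnorm (\<theta> *v of_int_vec q + real_of_int (q $ j0) *\<^sub>R x + of_int_vec p) \<le> \<epsilon> / t ^ ?n"
        using that(2) by (simp add: add_column_matrix_mult)
      then have "q $ j0 = 0" using x q by (auto simp: Bad_def)
      then have "q = 0" using elim(1) p q by (auto simp: t_def)
      then have "supnorm (of_int_vec p) \<le> \<epsilon> / t ^ ?n" using p by simp
      also have "\<epsilon> < t ^ ?n"
        using eps(2) by (intro less_le_trans[OF _ one_le_power[OF t1]]) simp
      then have "\<epsilon> / t ^ ?n < 1"
        using t1 by simp
      finally have "\<bar>real_of_int (p $ i)\<bar> < 1" for i
        using abs_le_supnorm[of "of_int_vec p" i] by simp
      then have "p = 0" by (simp add: vec_eq_iff flip: of_int_abs)
      then show ?thesis using \<open>q = 0\<close> by simp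
    qed
    obtain p q where "\<And>i. int N dvd p $ i - w $ i" "\<And>j. int N dvd q $ j - v $ j"
      "\<And>j. t ^ ?m \<le> real_of_int (q $ j)" "\<And>j. real_of_int (q $ j) \<le> real (2 * N * K + 1) * t ^ ?m"
      "supnorm ((\<theta> + column_matrix j0 x) *v of_int_vec q + of_int_vec p) \<le> real (2 * N * K
        + 1) * (1 / t ^ ?n)"
      by (rule congruent_solution[where X = "\<theta> + column_matrix j0 x" and w = w and v = v and K = K
            and \<epsilon> = \<epsilon> and s = "1 / t ^ ?n" and T = "t ^ ?m", OF _ _ vol _ _ K short N])
        (use t1 eps in auto)
    then show ?thesis
      by (intro exI[of _ p] exI[of _ q]) (simp add: add_column_matrix_mult)
  qed
  have "Bad \<in> fmeasurable lborel \<and> measure lborel Bad \<le> measure lborel (ball x0 R) / 2"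
    unfolding Bad_def t_def by (rule elim(2))
  then show ?case
    by (intro exI[of _ Bad] conjI ballI) (simp_all only: sol[unfolded t_def])
qed

section \<open>Cauchy condensation\<close>

text \<open>The block from \<open>c * A ^ l\<close> to \<open>c * A ^ Suc l\<close> has at most
  \<open>c * A * A ^ l\<close> terms, each at most \<open>\<psi> (c * A ^ l)\<close>, so summability
  of the condensed series would bound the partial sums of \<open>\<psi>\<close>. The offset
  \<open>c\<close> is there because the approximations have height up to a constant times the
  scale.\<close>

lemma not_summable_condensed:
  fixes \<psi> :: "nat \<Rightarrow> real"
  assumes pos: "\<And>k. k \<ge> 1 \<Longrightarrow> \<psi> k > 0"
    and noninc: "\<And>a b. 1 \<le> a \<Longrightarrow> a \<le> b \<Longrightarrow> \<psi> b \<le> \<psi> a"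
    and diverge: "\<not> summable \<psi>" and A: "A \<ge> 2" and c: "c \<ge> 1"
  shows "\<not> summable (\<lambda>k. real (A ^ k) * \<psi> (c * A ^ k))"
proof
  let ?f = "\<lambda>k. real (A ^ k) * \<psi> (c * A ^ k)"
  assume summable: "summable ?f"
  have arg: "1 \<le> c * A ^ k" for k using A c by simp
  have nonneg: "0 \<le> ?f k" for k using pos[OF arg[of k]] by (simp add: less_imp_le)
  have bound: "sum \<psi> {1..<c * A ^ l} \<le> sum \<psi> {1..<c} + real (c * A) * (\<Sum>k<l. ?f k)" for l
  proof (induction l)
    case (Suc l)
    have le: "c * A ^ l \<le> c * A ^ Suc l" using A by simp
    have "sum \<psi> {1..<c * A ^ Suc l} = sum \<psi> {1..<c * A ^ l} + sum \<psi> {c * A ^ l..<c * A ^ Suc l}"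
      by (rule sum.atLeastLessThan_concat[OF arg le, symmetric])
    also have "sum \<psi> {c * A ^ l..<c * A ^ Suc l} \<le> real (c * A ^ Suc l - c * A ^ l) * \<psi> (c * A ^ l)"
      using sum_bounded_above[of "{c * A ^ l..<c * A ^ Suc l}" \<psi> "\<psi> (c * A ^ l)"] noninc[OF arg] by simp
    also have "\<dots> \<le> real (c * A ^ Suc l) * \<psi> (c * A ^ l)"
      by (intro mult_right_mono less_imp_le[OF pos[OF arg]]) (simp only: of_nat_le_iff diff_le_self)
    also have "\<dots> = real (c * A) * ?f l" by simp
    finally show ?case using Suc by (simp add: algebra_simps)
  qed simp
  \<comment> \<open>Shifted by one because nothing is assumed about the value
    \<open>\<psi> 0\<close>.\<close>
  have "(\<Sum>i\<le>k. \<psi> (Suc i)) \<le> sum \<psi> {1..<c} + real (c * A) * suminf ?f" for k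
  proof -
    have "Suc (Suc k) \<le> c * A ^ Suc (Suc k)"
    proof -
      have "Suc (Suc k) < A ^ Suc (Suc k)"
        using A by (intro power_gt_expt) simp
      also have "\<dots> \<le> c * A ^ Suc (Suc k)" using c by simp
      finally show ?thesis by simp
    qed
    then have "sum \<psi> {1..<Suc (Suc k)} \<le> sum \<psi> {1..<c * A ^ Suc (Suc k)}"
      using pos by (intro sum_mono2) (auto simp: less_imp_le)
    also note bound
    also have "(\<Sum>k<Suc (Suc k). ?f k) \<le> suminf ?f"
      using summable nonneg by (intro sum_le_suminf) auto
    finally have "sum \<psi> {1..<Suc (Suc k)} \<le> sum \<psi> {1..<c} + real (c * A) * suminf ?f"
      by (simp add: mult_left_mono)
    moreover have "(\<Sum>i\<le>k. \<psi> (Suc i)) = sum \<psi> {1..<Suc (Suc k)}"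
      using sum.shift_bounds_Suc_ivl[of \<psi> 0 "Suc k"] by (simp add: atLeast0LessThan lessThan_Suc_atMost)
    ultimately show ?thesis by simp
  qed
  then have "summable (\<lambda>i. \<psi> (Suc i))"
    using pos by (intro bounded_imp_summable) (auto simp: less_imp_le)
  then show False using diverge summable_Suc_iff by blast
qed

section \<open>Divergence for ubiquitous systems of points\<close>

text \<open>Packing: the balls of radius \<open>\<sigma>\<close> around the points are disjoint and
  lie in the ball of radius \<open>R\<close>.\<close>

lemma card_separated_le:
  fixes P :: "'a::euclidean_space set"
  assumes "finite P" and sep: "\<And>y y'. y \<in> P \<Longrightarrow> y' \<in> P \<Longrightarrow> y \<noteq> y' \<Longrightarrow> 2 * \<sigma> < dist y y'"
    and near: "\<And>y. y \<in> P \<Longrightarrow> dist x y + \<sigma> \<le> R" and pos: "\<sigma> > 0" "R > 0"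
  shows "real (card P) * \<sigma> ^ DIM('a) \<le> R ^ DIM('a)"
proof -
  have "disjoint_family_on (\<lambda>y. ball y \<sigma>) P"
    unfolding disjoint_family_on_def
  proof (intro ballI impI)
    fix y y' assume "y \<in> P" "y' \<in> P" "y \<noteq> y'"
    then have "2 * \<sigma> < dist y y'" by (rule sep)
    then show "ball y \<sigma> \<inter> ball y' \<sigma> = {}"
      by (intro disjoint_ballI) simp
  qed
  then have "(\<Sum>y\<in>P. measure lborel (ball y \<sigma>)) = measure lborel (\<Union>y\<in>P. ball y \<sigma>)"
    using \<open>finite P\<close> emeasure_bounded_finite[OF bounded_ball]
    by (intro measure_finite_Union[symmetric]) (auto simp: less_top)
  also have "\<dots> \<le> measure lborel (ball x R)"
  proof (rule measure_mono_fmeasurable)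
    show "(\<Union>y\<in>P. ball y \<sigma>) \<subseteq> ball x R"
    proof clarsimp
      fix z y assume "y \<in> P" "dist y z < \<sigma>"
      then show "dist x z < R" using near[of y] dist_triangle[of x z y] by linarith
    qed
    show "ball x R \<in> fmeasurable lborel"
      using emeasure_bounded_finite[OF bounded_ball] by (auto simp: fmeasurable_def)
  qed (auto intro!: borel_open open_UN)
  finally show ?thesis
    using pos by (simp add: content_ball mult.left_commute)
qed

text \<open>Packing bounds the size of separated subsets, so one of largest cardinality exists; a
  point farther than \<open>2 * \<sigma>\<close> from all of it could be added.\<close>

lemma maximal_separated_subset:
  fixes Y :: "'a::euclidean_space set"
  assumes near: "\<And>y. y \<in> Y \<Longrightarrow> dist x y + \<sigma> \<le> R" and pos: "\<sigma> > 0" "R > 0"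
  shows "\<exists>P. finite P \<and> P \<subseteq> Y \<and> (\<forall>y\<in>P. \<forall>y'\<in>P. y \<noteq> y' \<longrightarrow> 2 * \<sigma> < dist y y')
    \<and> (\<forall>y\<in>Y. \<exists>p\<in>P. dist y p \<le> 2 * \<sigma>)"
proof -
  define sep where "sep P \<longleftrightarrow> finite P \<and> P \<subseteq> Y \<and> (\<forall>y\<in>P. \<forall>y'\<in>P. y \<noteq> y' \<longrightarrow> 2 * \<sigma> < dist y y')" for P
  have "card P \<le> nat \<lfloor>R ^ DIM('a) / \<sigma> ^ DIM('a)\<rfloor>" if "sep P" for P
  proof -
    have "real (card P) * \<sigma> ^ DIM('a) \<le> R ^ DIM('a)"
      using that near pos by (intro card_separated_le[of P \<sigma> x R]) (auto simp: sep_def)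
    then have "real (card P) \<le> R ^ DIM('a) / \<sigma> ^ DIM('a)"
      using pos by (simp add: pos_le_divide_eq)
    then show ?thesis by (simp add: le_nat_floor)
  qed
  moreover have "sep {}" by (simp add: sep_def)
  ultimately obtain P where P: "sep P" "\<And>P'. sep P' \<Longrightarrow> card P' \<le> card P"
    using ex_has_greatest_nat[of sep "{}" card] by (metis le_imp_less_Suc)
  have "\<exists>p\<in>P. dist y p \<le> 2 * \<sigma>" if "y \<in> Y" for y
  proof (rule ccontr)
    assume far: "\<not> ?thesis"
    then have "y \<notin> P" using pos by auto
    moreover have "sep (insert y P)"
      using P(1) that far by (auto simp: sep_def dist_commute not_le)
    ultimately show False
      using P(2)[of "insert y P"] P(1) by (simp add: sep_def)
  qed
  then show ?thesis using P(1) by (auto simp: sep_def)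
qed

lemma sum_inverse_power_le:
  fixes u :: real
  assumes "u \<ge> 2"
  shows "(\<Sum>i\<in>{k..<k + l}. (1 / u) ^ (k + l - i)) \<le> 2 / u"
proof (induction l)
  case (Suc l)
  have "(\<Sum>i\<in>{k..<k + Suc l}. (1 / u) ^ (k + Suc l - i))
      = (\<Sum>i\<in>{k..<k + l}. (1 / u) ^ (Suc (k + l - i))) + 1 / u"
    by (simp add: Suc_diff_le)
  also have "\<dots> = ((\<Sum>i\<in>{k..<k + l}. (1 / u) ^ (k + l - i)) + 1) / u"
    by (simp add: sum_divide_distrib add_divide_distrib)
  also have "\<dots> \<le> (2 / u + 1) / u"
    using Suc assms by (intro divide_right_mono add_right_mono) auto
  also have "\<dots> \<le> 2 / u"
    using assms by (intro divide_right_mono) (auto simp: divide_le_eq)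
  finally show ?case .
qed (use assms in auto)

lemma power_add_le:
  fixes a b :: real
  assumes "a \<ge> 0" "b \<ge> 0"
  shows "(a + b) ^ m \<le> 2 ^ m * (a ^ m + b ^ m)"
proof -
  have "(a + b) ^ m \<le> (2 * max a b) ^ m"
    using assms by (intro power_mono) auto
  also have "\<dots> = 2 ^ m * max a b ^ m" by (rule power_mult_distrib)
  also have "max a b ^ m \<le> a ^ m + b ^ m"
    using assms by (auto simp: max_def)
  finally show ?thesis by simp
qed

text \<open>\<open>S k\<close> are the resonant points of scale \<open>k\<close>,
  \<open>\<sigma> k\<close> is the distance within which they cover at least half of the ball,
  \<open>\<rho> k\<close> the radius of approximation wanted around them, and \<open>b k\<close> the
  resulting relative volume. The bound on \<open>u\<close> is what
  \<open>neighbourhood_volume\<close> consumes: it makes \<open>2 ^ m * (2 / u)\<close> at most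
  \<open>1 / (8 * 4 ^ m)\<close>. The bound \<open>2 * \<sigma> k \<le> R\<close> keeps the balls
  around chosen centres inside radius \<open>2 * R\<close>.\<close>

locale ubiquitous_system =
  fixes S :: "nat \<Rightarrow> 'a::euclidean_space set" and \<rho> \<sigma> b :: "nat \<Rightarrow> real"
    and Bad :: "nat \<Rightarrow> 'a set"
    and x0 :: 'a and R u D :: real and k1 :: nat
  assumes R: "R > 0" and D: "D > 0" and u: "u \<ge> 4 ^ DIM('a) * 2 ^ DIM('a) * 16"
    and sigma: "\<And>k. \<sigma> k = D / u ^ k" and sigma_small: "\<And>k. k \<ge> k1 \<Longrightarrow> 2 * \<sigma> k \<le> R"
    and rho: "\<And>k. 0 \<le> \<rho> k" "\<And>k. \<rho> k \<le> \<sigma> k"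
    and b: "\<And>k. b k = (\<rho> k / \<sigma> k) ^ DIM('a)"
    and Bad: "\<And>k. k \<ge> k1 \<Longrightarrow> Bad k \<in> fmeasurable lborel"
    "\<And>k. k \<ge> k1 \<Longrightarrow> measure lborel (Bad k) \<le> measure lborel (ball x0 R) / 2"
    and cover: "\<And>k x. k \<ge> k1 \<Longrightarrow> x \<in> ball x0 R - Bad k \<Longrightarrow> \<exists>y\<in>S k. dist x y \<le> \<sigma> k"
begin

text \<open>
  The centres at each scale are chosen outside neighbourhoods of the balls of the earlier scales, so that all
  the balls are disjoint. These neighbourhoods stay small as long as the sum of the relative volumes \<open>b\<close> is small.
\<close>

definition selected :: "(nat \<Rightarrow> 'a set) \<Rightarrow> nat \<Rightarrow> bool" where
  "selected P k \<longleftrightarrow> finite (P k) \<and> P k \<subseteq> S k \<and> (\<forall>y\<in>P k. dist x0 y + \<sigma> k < 2 * R)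
    \<and> (\<forall>y\<in>P k. \<forall>y'\<in>P k. y \<noteq> y' \<longrightarrow> 2 * \<sigma> k < dist y y')
    \<and> R ^ DIM('a) \<le> 4 * 3 ^ DIM('a) * (real (card (P k)) * \<sigma> k ^ DIM('a))
    \<and> (\<forall>i\<in>{k1..<k}. \<forall>y\<in>P i. \<forall>y'\<in>P k. \<rho> i + \<rho> k < dist y y')"

text \<open>Choosing centres at a later scale must not disturb the scales already treated.\<close>

lemma selected_cong:
  assumes "\<And>i. i \<le> k \<Longrightarrow> P i = P' i"
  shows "selected P k = selected P' k"
proof -
  have "(\<forall>i\<in>{k1..<k}. \<forall>y\<in>P i. \<forall>y'\<in>P' k. \<rho> i + \<rho> k < dist y y')
      = (\<forall>i\<in>{k1..<k}. \<forall>y\<in>P' i. \<forall>y'\<in>P' k. \<rho> i + \<rho> k < dist y y')"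
    using assms by (intro ball_cong refl) simp
  then show ?thesis
    unfolding selected_def assms[OF order.refl] by (rule arg_cong)
qed

lemma u_ge_2: "u \<ge> 2"
proof -
  have "(1::real) * 1 * 16 \<le> 4 ^ DIM('a) * 2 ^ DIM('a) * 16"
    by (intro mult_mono) auto
  then show ?thesis using u by linarith
qed

lemma sigma_pos: "\<sigma> k > 0"
  using D u_ge_2 by (simp add: sigma)

lemma b_nonneg: "b k \<ge> 0"
  using rho sigma_pos[of k] by (simp add: b)

text \<open>Packing bounds \<open>card (P i) * \<sigma> i ^ m\<close> by \<open>(2 * R) ^ m\<close>.
  The radius is at most \<open>\<rho> i + 2 * \<sigma> k\<close>; its first part contributes the
  relative volume \<open>b i\<close>, its second a power of
  \<open>\<sigma> k / \<sigma> i = (1 / u) ^ (k - i)\<close>, which sums geometrically. Each part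
  yields at most \<open>R ^ m / 8\<close>.\<close>

lemma neighbourhood_volume:
  assumes P: "\<And>i. i \<in> {k1..<k} \<Longrightarrow> selected P i"
    and sum: "(\<Sum>i\<in>{k1..<k}. b i) \<le> 1 / (8 * 4 ^ DIM('a))"
  shows "(\<Sum>i\<in>{k1..<k}. real (card (P i)) * (\<rho> i + \<rho> k + \<sigma> k) ^ DIM('a)) \<le> R ^ DIM('a) / 4"
    (is "?L \<le> _")
proof (cases "k1 \<le> k")
  case True
  let ?m = "DIM('a)"
  have summand: "real (card (P i)) * (\<rho> i + \<rho> k + \<sigma> k) ^ ?m
      \<le> (4 * R) ^ ?m * (b i + 2 ^ ?m * (1 / u) ^ (k - i))" if i: "i \<in> {k1..<k}" for i
  proof -
    have "real (card (P i)) * \<sigma> i ^ ?m \<le> (2 * R) ^ ?m"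
      using P[OF i] R sigma_pos by (intro card_separated_le[of "P i" _ x0]) (auto simp: selected_def)
    have ratio: "\<sigma> k / \<sigma> i = (1 / u) ^ (k - i)"
      using D u_ge_2 i by (simp add: sigma power_diff power_divide)
    have "(\<rho> i + \<rho> k + \<sigma> k) ^ ?m \<le> (\<rho> i + 2 * \<sigma> k) ^ ?m"
      using rho(1)[of i] rho(1)[of k] rho(2)[of k] sigma_pos[of k] by (intro power_mono) auto
    also have "\<dots> \<le> 2 ^ ?m * (\<rho> i ^ ?m + (2 * \<sigma> k) ^ ?m)"
      using rho(1)[of i] sigma_pos[of k] by (intro power_add_le) auto
    also have "\<rho> i ^ ?m + (2 * \<sigma> k) ^ ?m = \<sigma> i ^ ?m * (b i + 2 ^ ?m * (\<sigma> k / \<sigma> i) ^ ?m)"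
      using sigma_pos[of i] by (simp add: b power_divide power_mult_distrib field_simps)
    also have "(\<sigma> k / \<sigma> i) ^ ?m \<le> (1 / u) ^ (k - i)"
    proof -
      have "((1 / u) ^ (k - i)) ^ ?m \<le> ((1 / u) ^ (k - i)) ^ 1"
        using u_ge_2 by (intro power_decreasing) (auto simp: Suc_le_eq power_le_one)
      then show ?thesis by (simp only: ratio) simp
    qed
    finally have "(\<rho> i + \<rho> k + \<sigma> k) ^ ?m \<le> 2 ^ ?m * (\<sigma> i ^ ?m * (b i + 2 ^ ?m * (1 / u) ^ (k - i)))"
      using sigma_pos[of i] by simp
    then have "real (card (P i)) * (\<rho> i + \<rho> k + \<sigma> k) ^ ?m
        \<le> real (card (P i)) * (2 ^ ?m * (\<sigma> i ^ ?m * (b i + 2 ^ ?m * (1 / u) ^ (k - i))))"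
      by (intro mult_left_mono) auto
    also have "\<dots> = (real (card (P i)) * \<sigma> i ^ ?m) * (2 ^ ?m * (b i + 2 ^ ?m * (1 / u) ^ (k - i)))"
      by (simp add: algebra_simps)
    also have "\<dots> \<le> (2 * R) ^ ?m * (2 ^ ?m * (b i + 2 ^ ?m * (1 / u) ^ (k - i)))"
      using \<open>real (card (P i)) * \<sigma> i ^ ?m \<le> _\<close> b_nonneg[of i] u_ge_2
      by (intro mult_right_mono) auto
    also have "\<dots> = (2 * R * 2) ^ ?m * (b i + 2 ^ ?m * (1 / u) ^ (k - i))"
      by (simp only: power_mult_distrib mult.assoc)
    also have "2 * R * 2 = 4 * R" by simp
    finally show ?thesis .
  qed
  have "?L \<le> (\<Sum>i\<in>{k1..<k}. (4 * R) ^ ?m * (b i + 2 ^ ?m * (1 / u) ^ (k - i)))"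
    by (intro sum_mono summand)
  also have "\<dots> = (4 * R) ^ ?m * ((\<Sum>i\<in>{k1..<k}. b i) + 2 ^ ?m * (\<Sum>i\<in>{k1..<k}. (1 / u) ^ (k - i)))"
    by (simp only: sum_distrib_left sum.distrib[symmetric])
  also have "\<dots> \<le> (4 * R) ^ ?m * (1 / (8 * 4 ^ ?m) + 2 ^ ?m * (2 / u))"
    using sum sum_inverse_power_le[OF u_ge_2, of k1 "k - k1"] True R
    by (intro mult_left_mono add_mono) auto
  also have "\<dots> \<le> (4 * R) ^ ?m * (1 / (8 * 4 ^ ?m) + 1 / (8 * 4 ^ ?m))"
  proof -
    have "2 ^ ?m * (2 / u) \<le> 2 ^ ?m * (2 / (4 ^ ?m * 2 ^ ?m * 16))"
      using u u_ge_2 by (intro mult_left_mono divide_left_mono) auto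
    also have "\<dots> = 1 / (8 * 4 ^ ?m)" by (simp add: field_simps)
    finally show ?thesis using R by (intro mult_left_mono add_mono) auto
  qed
  also have "\<dots> = R ^ ?m / 4" by (simp add: power_mult_distrib)
  finally show ?thesis .
qed (use R in auto)

text \<open>The set \<open>Bad k\<close> takes at most half of the ball and the neighbourhoods of
  earlier centres at most a quarter. The remaining quarter is covered by balls of radius
  \<open>3 * \<sigma> k\<close> around separated points, which forces the number of these points to
  be of the maximal order.\<close>

lemma select_next:
  assumes k: "k1 \<le> k" and P: "\<And>i. i \<in> {k1..<k} \<Longrightarrow> selected P i"
    and sum: "(\<Sum>i\<in>{k1..<k}. b i) \<le> 1 / (8 * 4 ^ DIM('a))"
  shows "\<exists>X. selected (P(k := X)) k"
proof -
  let ?m = "DIM('a)" and ?v = "unit_ball_vol (real DIM('a))"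
  have fin: "emeasure lborel (cball y r) < \<infinity>" for y :: 'a and r
    by (rule emeasure_bounded_finite) simp
  have ballf: "ball x0 R \<in> fmeasurable lborel"
    using emeasure_bounded_finite[OF bounded_ball] by (auto simp: fmeasurable_def)
  have cballf: "cball y r \<in> fmeasurable lborel" for y :: 'a and r
    using fin by (auto simp: fmeasurable_def)
  define I where "I = Sigma {k1..<k} P"
  have finI: "finite I"
    unfolding I_def using P by (intro finite_SigmaI) (auto simp: selected_def)
  \<comment> \<open>The extra \<open>\<sigma> k\<close> allows for the new centre being only within
    \<open>\<sigma> k\<close> of a point outside \<open>N\<close>; its distance to the earlier
    centres still exceeds \<open>\<rho> i + \<rho> k\<close>.\<close>
  define N where "N = (\<Union>p\<in>I. cball (snd p) (\<rho> (fst p) + \<rho> k + \<sigma> k))"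
  have r0: "0 \<le> \<rho> i + \<rho> k + \<sigma> k" for i
    using rho(1)[of i] rho(1)[of k] sigma_pos[of k] by linarith
  have Nf: "N \<in> fmeasurable lborel"
    unfolding N_def using finI cballf by (intro fmeasurable.finite_UN) auto
  have "measure lborel N \<le> (\<Sum>p\<in>I. measure lborel (cball (snd p) (\<rho> (fst p) + \<rho> k + \<sigma> k)))"
    unfolding N_def using finI cballf by (intro measure_UNION_le) (auto simp: fmeasurable_def)
  also have "\<dots> = (\<Sum>p\<in>I. ?v * (\<rho> (fst p) + \<rho> k + \<sigma> k) ^ ?m)"
    using r0 by (simp add: content_cball)
  also have "\<dots> = (\<Sum>i\<in>{k1..<k}. \<Sum>y\<in>P i. ?v * (\<rho> i + \<rho> k + \<sigma> k) ^ ?m)"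
    unfolding I_def using P by (subst sum.Sigma) (auto simp: selected_def case_prod_beta)
  also have "\<dots> = ?v * (\<Sum>i\<in>{k1..<k}. real (card (P i)) * (\<rho> i + \<rho> k + \<sigma> k) ^ ?m)"
    by (simp add: sum_distrib_left algebra_simps)
  also have "\<dots> \<le> ?v * (R ^ ?m / 4)"
    using neighbourhood_volume[OF P sum] by (intro mult_left_mono) auto
  finally have N: "measure lborel N \<le> ?v * R ^ ?m / 4" by simp
  define G where "G = ball x0 R - Bad k - N"
  have Gf: "G \<in> fmeasurable lborel"
    unfolding G_def using ballf Bad(1)[OF k] Nf by (intro fmeasurable.Diff) auto
  note meas = fmeasurableD[OF Gf] fmeasurableD[OF Bad(1)[OF k]] fmeasurableD[OF Nf]
  have "ball x0 R \<subseteq> G \<union> Bad k \<union> N"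
    by (auto simp: G_def)
  then have "measure lborel (ball x0 R) \<le> measure lborel (G \<union> Bad k \<union> N)"
    using Gf Bad(1)[OF k] Nf fmeasurableD[OF ballf]
    by (intro measure_mono_fmeasurable fmeasurable.Un)
  also have "\<dots> \<le> measure lborel (G \<union> Bad k) + measure lborel N"
    by (rule measure_Un_le[OF sets.Un[OF meas(1,2)] meas(3)])
  also have "\<dots> \<le> measure lborel G + measure lborel (Bad k) + measure lborel N"
    by (rule add_right_mono[OF measure_Un_le[OF meas(1,2)]])
  finally have Gm: "?v * R ^ ?m / 4 \<le> measure lborel G"
    using Bad(2)[OF k] N R by (simp add: content_ball)
  define Y where "Y = {y \<in> S k. \<exists>x\<in>G. dist x y \<le> \<sigma> k}"
  have near: "dist x0 y + \<sigma> k < 2 * R" if y: "y \<in> Y" for y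
  proof -
    obtain x where "x \<in> G" "dist x y \<le> \<sigma> k"
      using y by (auto simp: Y_def)
    moreover from this have "dist x0 x < R" by (simp add: G_def)
    ultimately show ?thesis using sigma_small[OF k] dist_triangle[of x0 y x] by linarith
  qed
  have "\<exists>X. finite X \<and> X \<subseteq> Y \<and> (\<forall>y\<in>X. \<forall>y'\<in>X. y \<noteq> y' \<longrightarrow> 2 * \<sigma> k < dist y y')
    \<and> (\<forall>y\<in>Y. \<exists>p\<in>X. dist y p \<le> 2 * \<sigma> k)"
  proof (rule maximal_separated_subset)
    show "dist x0 y + \<sigma> k \<le> 2 * R" if "y \<in> Y" for y
      using near[OF that] by simp
  qed (use sigma_pos R in simp_all)
  then obtain X where X: "finite X" "X \<subseteq> Y" "\<forall>y\<in>X. \<forall>y'\<in>X. y \<noteq> y' \<longrightarrow> 2 * \<sigma> k < dist y y'"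
    "\<forall>y\<in>Y. \<exists>p\<in>X. dist y p \<le> 2 * \<sigma> k"
    by blast
  \<comment> \<open>The radius is \<open>\<sigma> k\<close> from a point of \<open>G\<close> to some
    \<open>y\<close> in \<open>Y\<close>, plus \<open>2 * \<sigma> k\<close> from \<open>y\<close>
    to the maximal separated set.\<close>
  have "G \<subseteq> (\<Union>p\<in>X. cball p (3 * \<sigma> k))"
  proof
    fix x assume x: "x \<in> G"
    then obtain y where y: "y \<in> S k" "dist x y \<le> \<sigma> k"
      using cover[OF k, of x] by (auto simp: G_def)
    then obtain p where "p \<in> X" "dist y p \<le> 2 * \<sigma> k"
      using X(4) x unfolding Y_def by blast
    moreover from this have "dist p x \<le> 3 * \<sigma> k"
      using y(2) dist_triangle[of p x y] by (simp add: dist_commute)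
    ultimately show "x \<in> (\<Union>p\<in>X. cball p (3 * \<sigma> k))" by auto
  qed
  then have "measure lborel G \<le> measure lborel (\<Union>p\<in>X. cball p (3 * \<sigma> k))"
    by (rule measure_mono_fmeasurable[OF _ fmeasurableD[OF Gf] fmeasurable.finite_UN[OF X(1) cballf]])
  also have "\<dots> \<le> (\<Sum>p\<in>X. measure lborel (cball p (3 * \<sigma> k)))"
    by (rule measure_UNION_le[OF X(1)]) simp
  also have "\<dots> = ?v * (3 ^ ?m * (real (card X) * \<sigma> k ^ ?m))"
    using sigma_pos[of k] by (simp add: content_cball power_mult_distrib)
  finally have "?v * R ^ ?m / 4 \<le> ?v * (3 ^ ?m * (real (card X) * \<sigma> k ^ ?m))"
    using Gm by linarith
  then have card: "R ^ ?m \<le> 4 * 3 ^ ?m * (real (card X) * \<sigma> k ^ ?m)"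
    by (simp add: field_simps)
  have cross: "\<rho> i + \<rho> k < dist y y'" if i: "i \<in> {k1..<k}" and y: "y \<in> P i" "y' \<in> X" for i y y'
  proof -
    obtain x where x: "x \<in> G" "dist x y' \<le> \<sigma> k"
      using X(2) y(2) by (auto simp: Y_def)
    have "(i, y) \<in> I" using i y by (auto simp: I_def)
    then have "\<not> dist y x \<le> \<rho> i + \<rho> k + \<sigma> k"
      using x(1) by (force simp: G_def N_def)
    then show ?thesis using x(2) dist_triangle[of y x y'] by (simp add: dist_commute)
  qed
  have "selected (P(k := X)) k"
    unfolding selected_def fun_upd_same
  proof (intro conjI)
    show "X \<subseteq> S k" using X(2) by (auto simp: Y_def)
    show "\<forall>y\<in>X. dist x0 y + \<sigma> k < 2 * R" using near X(2) by blast
    show "\<forall>i\<in>{k1..<k}. \<forall>y\<in>(P(k := X)) i. \<forall>y'\<in>X. \<rho> i + \<rho> k < dist y y'"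
      using cross by simp
  qed (fact X(1) X(3) card)+
  then show ?thesis by blast
qed

lemma select_upto:
  assumes "(\<Sum>i\<in>{k1..<k1 + l}. b i) \<le> 1 / (8 * 4 ^ DIM('a))"
  shows "\<exists>P. \<forall>k\<in>{k1..<k1 + l}. selected P k"
  using assms
proof (induction l)
  case (Suc l)
  have le: "(\<Sum>i\<in>{k1..<k1 + l}. b i) \<le> 1 / (8 * 4 ^ DIM('a))"
    using Suc.prems b_nonneg[of "k1 + l"] by simp
  then obtain P where P: "\<forall>k\<in>{k1..<k1 + l}. selected P k" using Suc.IH by blast
  then obtain X where X: "selected (P(k1 + l := X)) (k1 + l)"
    using select_next[of "k1 + l" P] le by auto
  have "selected (P(k1 + l := X)) k" if "k \<in> {k1..<k1 + l}" for k
    using P that selected_cong[of k "P(k1 + l := X)" P] by simp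
  then have "\<forall>k\<in>{k1..<k1 + Suc l}. selected (P(k1 + l := X)) k"
    using X by (simp add: atLeastLessThanSuc del: fun_upd_apply)
  then show ?case by blast
qed simp

text \<open>Scales are used until the sum of \<open>b\<close> first reaches \<open>\<tau>\<close>.
  The selected balls are disjoint and number at least a constant times
  \<open>(R / \<sigma> k) ^ m\<close> at each scale, so their total volume is at least a constant
  times \<open>R ^ m * \<tau>\<close>.\<close>

lemma limsup_volume:
  assumes b_small: "\<And>k. b k \<le> 1 / (16 * 4 ^ DIM('a))" and diverge: "\<not> summable b"
  obtains E where "E \<in> fmeasurable lborel" "E \<subseteq> (\<Union>k\<in>{k1..}. \<Union>y\<in>S k. cball y (\<rho> k))"
    "E \<subseteq> ball x0 (2 * R)"
    "measure lborel (ball x0 (2 * R)) \<le> 64 * 24 ^ DIM('a) * measure lborel E"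
proof -
  let ?m = "DIM('a)" and ?v = "unit_ball_vol (real DIM('a))"
  define \<tau> :: real where "\<tau> = 1 / (16 * 4 ^ ?m)"
  have ex: "\<exists>l. \<tau> \<le> (\<Sum>i\<in>{k1..<k1 + l}. b i)"
  proof (rule ccontr)
    assume "\<not> ?thesis"
    moreover have "(\<Sum>i\<in>{k1..<k1 + l}. b i) = (\<Sum>i<l. b (i + k1))" for l
      using sum.shift_bounds_nat_ivl[of b 0 k1 l] by (simp add: lessThan_atLeast0 add.commute)
    ultimately have "(\<Sum>i<l. b (i + k1)) \<le> \<tau>" for l
      by (simp add: not_le less_imp_le)
    then have "(\<Sum>i\<le>n. b (i + k1)) \<le> \<tau>" for n
      by (metis lessThan_Suc_atMost)
    then have "summable (\<lambda>i. b (i + k1))"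
      using b_nonneg by (intro bounded_imp_summable[of _ \<tau>]) auto
    then show False using diverge by simp
  qed
  define l where "l = (LEAST l. \<tau> \<le> (\<Sum>i\<in>{k1..<k1 + l}. b i))"
  have l: "\<tau> \<le> (\<Sum>i\<in>{k1..<k1 + l}. b i)"
    unfolding l_def by (rule LeastI_ex[OF ex])
  have l': "(\<Sum>i\<in>{k1..<k1 + l'}. b i) < \<tau>" if "l' < l" for l'
    using not_less_Least[OF that[unfolded l_def]] by simp
  have "\<tau> > 0" by (simp add: \<tau>_def)
  then obtain l0 where l0: "l = Suc l0" using l by (cases l) auto
  \<comment> \<open>Before the last scale the sum is below \<open>\<tau>\<close>, and one term adds
    at most \<open>\<tau>\<close>; the total \<open>2 * \<tau>\<close> is exactly the limit allowed
    in \<open>select_upto\<close>.\<close>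
  have "(\<Sum>i\<in>{k1..<k1 + l}. b i) \<le> 1 / (8 * 4 ^ ?m)"
    using l'[of l0] b_small[of "k1 + l0"] by (simp add: l0 \<tau>_def)
  then obtain P where P: "\<And>k. k \<in> {k1..<k1 + l} \<Longrightarrow> selected P k"
    using select_upto[of l] by blast
  define I where "I = Sigma {k1..<k1 + l} P"
  have finI: "finite I"
    unfolding I_def using P by (intro finite_SigmaI) (auto simp: selected_def)
  define E where "E = (\<Union>p\<in>I. cball (snd p) (\<rho> (fst p)))"
  have fin: "emeasure lborel (cball y r) < \<infinity>" for y :: 'a and r
    by (rule emeasure_bounded_finite) simp
  have disj: "disjoint_family_on (\<lambda>p. cball (snd p) (\<rho> (fst p))) I"
    unfolding disjoint_family_on_def
  proof (intro ballI impI)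
    fix p q assume pq: "p \<in> I" "q \<in> I" "p \<noteq> q"
    obtain i y j z where eq: "p = (i, y)" "q = (j, z)" by fastforce
    have "\<rho> i + \<rho> j < dist y z"
    proof (cases i j rule: linorder_cases)
      case less
      then show ?thesis using pq P[of j] by (auto simp: eq I_def selected_def)
    next
      case greater
      then have "\<rho> j + \<rho> i < dist z y" using pq P[of i] by (auto simp: eq I_def selected_def)
      then show ?thesis by (simp add: dist_commute)
    next
      case equal
      then have "2 * \<sigma> i < dist y z" using pq P[of i] by (auto simp: eq I_def selected_def)
      then show ?thesis using rho(2)[of i] equal by simp
    qed
    then show "cball (snd p) (\<rho> (fst p)) \<inter> cball (snd q) (\<rho> (fst q)) = {}"
      by (simp add: eq disjoint_cballI)
  qed
  show ?thesis
  proof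
    show "E \<in> fmeasurable lborel"
      unfolding E_def using finI fin by (intro fmeasurable.finite_UN) (auto simp: fmeasurable_def)
    have elem: "\<exists>k y. k1 \<le> k \<and> y \<in> S k \<and> dist y x \<le> \<rho> k \<and> dist x0 y + \<sigma> k < 2 * R" if x: "x \<in> E" for x
    proof -
      obtain k y where ky: "k \<in> {k1..<k1 + l}" "y \<in> P k" "dist y x \<le> \<rho> k"
        using x by (auto simp: E_def I_def)
      have "y \<in> S k" "dist x0 y + \<sigma> k < 2 * R"
        using P[OF ky(1)] ky(2) unfolding selected_def by blast+
      then show ?thesis using ky by (intro exI[of _ k] exI[of _ y]) simp
    qed
    show "E \<subseteq> (\<Union>k\<in>{k1..}. \<Union>y\<in>S k. cball y (\<rho> k))"
      using elem by fastforce
    show "E \<subseteq> ball x0 (2 * R)"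
    proof
      fix x assume "x \<in> E"
      then obtain k y where "dist y x \<le> \<rho> k" "dist x0 y + \<sigma> k < 2 * R"
        using elem by blast
      then show "x \<in> ball x0 (2 * R)"
        using rho(2)[of k] dist_triangle[of x0 x y] by simp
    qed
    have "measure lborel E = (\<Sum>p\<in>I. measure lborel (cball (snd p) (\<rho> (fst p))))"
      unfolding E_def using finI disj fin by (intro measure_finite_Union) (auto simp: less_top)
    also have "\<dots> = (\<Sum>p\<in>I. ?v * \<rho> (fst p) ^ ?m)"
      using rho(1) by (simp add: content_cball)
    also have "\<dots> = (\<Sum>k\<in>{k1..<k1 + l}. \<Sum>y\<in>P k. ?v * \<rho> k ^ ?m)"
      unfolding I_def using P by (subst sum.Sigma) (auto simp: selected_def case_prod_beta)
    also have "\<dots> = (\<Sum>k\<in>{k1..<k1 + l}. ?v * (real (card (P k)) * \<sigma> k ^ ?m) * b k)"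
      using sigma_pos by (intro sum.cong) (auto simp: b power_divide less_imp_neq[symmetric])
    finally have E: "measure lborel E = (\<Sum>k\<in>{k1..<k1 + l}. ?v * (real (card (P k)) * \<sigma> k ^ ?m) * b k)" .
    \<comment> \<open>The final constant collects \<open>4 * 3 ^ m\<close> from the number of
      centres, \<open>16 * 4 ^ m\<close> from \<open>\<tau>\<close>, and \<open>2 ^ m\<close> from
      passing to the ball of radius \<open>2 * R\<close>.\<close>
    have "?v * R ^ ?m * \<tau> \<le> ?v * R ^ ?m * (\<Sum>k\<in>{k1..<k1 + l}. b k)"
      using l R by (intro mult_left_mono) auto
    also have "\<dots> = (\<Sum>k\<in>{k1..<k1 + l}. ?v * R ^ ?m * b k)" by (rule sum_distrib_left)
    also have "\<dots> \<le> (\<Sum>k\<in>{k1..<k1 + l}. ?v * (4 * 3 ^ ?m * (real (card (P k)) * \<sigma> k ^ ?m)) * b k)"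
    proof (intro sum_mono mult_right_mono mult_left_mono b_nonneg)
      show "R ^ ?m \<le> 4 * 3 ^ ?m * (real (card (P k)) * \<sigma> k ^ ?m)" if "k \<in> {k1..<k1 + l}" for k
        using P[OF that] unfolding selected_def by blast
    qed simp
    also have "\<dots> = 4 * 3 ^ ?m * measure lborel E"
      by (simp add: E sum_distrib_left algebra_simps)
    finally have "?v * R ^ ?m \<le> 64 * (3 ^ ?m * 4 ^ ?m) * measure lborel E"
      by (simp add: \<tau>_def field_simps)
    then have "2 ^ ?m * (?v * R ^ ?m) \<le> 2 ^ ?m * (64 * (3 ^ ?m * 4 ^ ?m) * measure lborel E)"
      by (intro mult_left_mono) auto
    also have "\<dots> = 64 * (2 * (3 * 4)) ^ ?m * measure lborel E"
      by (simp only: power_mult_distrib mult.assoc mult.left_commute)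
    also have "2 * (3 * 4) = (24 :: real)" by simp
    finally show "measure lborel (ball x0 (2 * R)) \<le> 64 * 24 ^ ?m * measure lborel E"
      using R by (simp add: content_ball power_mult_distrib mult.left_commute)
  qed
qed

end

section \<open>The Khintchine-Groshev theorem with congruences\<close>

lemma norm_le_card_supnorm: "norm x \<le> real CARD('k) * supnorm x" for x :: "real^'k"
proof -
  have "norm x \<le> (\<Sum>i\<in>UNIV. \<bar>x $ i\<bar>)" by (rule norm_le_l1_cart)
  also have "\<dots> \<le> real CARD('k) * supnorm x"
    using sum_bounded_above[of UNIV "\<lambda>i. \<bar>x $ i\<bar>" "supnorm x"] abs_le_supnorm[of x] by simp
  finally show ?thesis .
qed

lemma supnorm_le_norm: "supnorm x \<le> norm x" for x :: "real^'k"
  by (simp add: supnorm_le_iff component_le_norm_cart)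

lemma supnorm_power_le_iff: "supnorm x ^ k \<le> r \<longleftrightarrow> (\<forall>i. \<bar>x $ i\<bar> ^ k \<le> r)" for x :: "real^'k"
proof
  assume "supnorm x ^ k \<le> r"
  then show "\<forall>i. \<bar>x $ i\<bar> ^ k \<le> r"
    using power_mono[OF abs_le_supnorm abs_ge_zero, of x _ k] by (blast intro: order.trans)
next
  assume r: "\<forall>i. \<bar>x $ i\<bar> ^ k \<le> r"
  have "supnorm x \<in> range (\<lambda>i. \<bar>x $ i\<bar>)"
    unfolding supnorm_def by (rule Max_in) auto
  then show "supnorm x ^ k \<le> r" using r by auto
qed

lemma min_power_nonneg: "min x y ^ k = min (x ^ k) (y ^ k)" if "0 \<le> x" "0 \<le> y"
  for x y :: "'a::linordered_semidom"
  using that by (cases "x \<le> y") (simp_all add: min_absorb1 min_absorb2 power_mono)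

text \<open>A single modulus \<open>N\<close> replaces the individual ones: with \<open>N\<close>
  their product, congruence modulo \<open>N\<close> implies all of them.\<close>

definition congruent_solutions ::
  "(nat \<Rightarrow> real) \<Rightarrow> nat \<Rightarrow> int^'m \<Rightarrow> int^'n \<Rightarrow> real^'n^'m \<Rightarrow> ((int^'m) \<times> (int^'n)) set" where
  "congruent_solutions \<psi> N w v \<theta> = {(p, q).
     supnorm (\<theta> *v of_int_vec q + of_int_vec p) ^ CARD('m) \<le> \<psi> (nat (supnorm q ^ CARD('n)))
     \<and> (\<forall>i. int N dvd p $ i - w $ i) \<and> (\<forall>j. int N dvd q $ j - v $ j)}"

text \<open>Expresses infinitude by countable quantifiers, so that measurability in
  \<open>\<theta>\<close> becomes automatic.\<close>

lemma infinite_iff_to_nat_unbounded: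
  "infinite A \<longleftrightarrow> (\<forall>k. \<exists>z. z \<in> A \<and> k \<le> to_nat z)" for A :: "'a::countable set"
proof -
  have "infinite A \<longleftrightarrow> infinite (to_nat ` A)"
    by (simp add: finite_image_iff inj_on_def)
  also have "\<dots> \<longleftrightarrow> (\<forall>k. \<exists>n\<ge>k. n \<in> to_nat ` A)"
    by (rule infinite_nat_iff_unbounded_le)
  also have "\<dots> \<longleftrightarrow> (\<forall>k. \<exists>z. z \<in> A \<and> k \<le> to_nat z)"
    by (intro all_cong1) blast
  finally show ?thesis .
qed

lemma measurable_infinite_solutions:
  "{\<theta>. infinite (congruent_solutions \<psi> N w v \<theta>)} \<in> sets borel"
  unfolding infinite_iff_to_nat_unbounded congruent_solutions_def mem_Collect_eq case_prod_beta
    supnorm_power_le_iff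
  by measurable

text \<open>The points missed by all approximation balls of scales from \<open>k0\<close> on form a
  set \<open>F k0\<close>. By \<open>limsup_volume\<close> every ball has a fixed proportion outside
  \<open>F k0\<close>, so \<open>F k0\<close> is null; a point outside all of them has solutions
  with \<open>q $ j0\<close> arbitrarily large.\<close>

lemma AE_infinite_solutions_in_column:
  fixes \<theta> :: "real^'n^'m" and j0 :: 'n and w :: "int^'m" and v :: "int^'n" and M N K :: nat
    and \<psi> :: "nat \<Rightarrow> real"
  assumes pos: "\<And>k. k \<ge> 1 \<Longrightarrow> \<psi> k > 0"
    and noninc: "\<And>a b. 1 \<le> a \<Longrightarrow> a \<le> b \<Longrightarrow> \<psi> b \<le> \<psi> a"
    and diverge: "\<not> summable \<psi>"
    and M: "M \<ge> 4 ^ CARD('m) * 2 ^ CARD('m) * 16" and N: "N \<ge> 1" and eps: "0 < \<epsilon>" "\<epsilon> \<le> 1/2"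
    and small: "3 ^ CARD('n) * 8 ^ CARD('m) * \<epsilon> ^ (CARD('m) + CARD('n))
      \<le> unit_ball_vol (real CARD('m)) / 4"
    and K: "real K * \<epsilon> ^ (CARD('m) + CARD('n)) > 1"
    and generic: "\<forall>\<^sub>F k in sequentially. \<forall>p q. q \<noteq> 0 \<longrightarrow> q $ j0 = 0 \<longrightarrow>
      supnorm (of_int_vec q) \<le> \<epsilon> * (real M ^ k) ^ CARD('m) \<longrightarrow>
      \<not> supnorm (\<theta> *v of_int_vec q + of_int_vec p) \<le> \<epsilon> / (real M ^ k) ^ CARD('n)"
  shows "AE x in lborel. infinite (congruent_solutions \<psi> N w v (\<theta> + column_matrix j0 x))"
proof -
  let ?m = "CARD('m)" and ?n = "CARD('n)"
  have M2: "M \<ge> 2"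
  proof -
    have "(1::nat) * 1 * 16 \<le> 4 ^ ?m * 2 ^ ?m * 16"
      by (intro mult_mono) auto
    then show ?thesis using M by linarith
  qed
  define c where "c = 2 * N * K + 1"
  define T where "T k = (M ^ k) ^ ?m" for k
  \<comment> \<open>Dividing the error \<open>c / (M ^ k) ^ n\<close> by
    \<open>q $ j0 \<ge> T k\<close> gives distance \<open>c / u ^ k\<close> in the maximum norm; the
    factor \<open>m\<close> passes to the Euclidean norm. This explains \<open>u\<close> and
    \<open>\<sigma>\<close>.\<close>
  define D where "D = real ?m * real c"
  define u where "u = real M ^ (?m + ?n)"
  define \<sigma> where "\<sigma> k = D / u ^ k" for k
  define L where "L k = (c * T k) ^ ?n" for k
  \<comment> \<open>Since \<open>q $ j0 \<le> c * T k\<close>, the second term turns closeness to a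
    resonant point into the required inequality with \<open>\<psi> (L k)\<close>, where
    \<open>L k\<close> bounds the height of \<open>q\<close> to the power \<open>n\<close>. The cut
    at \<open>\<sigma> k / 64\<close> makes \<open>b k \<le> (1 / 64) ^ m\<close>, small enough for
    \<open>limsup_volume\<close>.\<close>
  define \<rho> where "\<rho> k = min (\<sigma> k / 64) (root ?m (\<psi> (L k)) / real (c * T k))" for k
  define good where "good k p q \<longleftrightarrow> (\<forall>i. int N dvd p $ i - w $ i) \<and> (\<forall>j. int N dvd q $ j - v $ j) \<and>
      (\<forall>j. real (T k) \<le> real_of_int (q $ j) \<and> real_of_int (q $ j) \<le> real c * real (T k))"
    for k and p :: "int^'m" and q :: "int^'n"
  define y where "y p q = - ((1 / real_of_int (q $ j0)) *\<^sub>R (\<theta> *v of_int_vec q + of_int_vec p))" for p q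
  define S where "S k = {y p q |p q. good k p q}" for k
  define F where "F k0 = - (\<Union>k\<in>{k0..}. \<Union>z\<in>S k. cball z (\<rho> k))" for k0
  have c1: "c \<ge> 1" by (simp add: c_def)
  have T1: "T k \<ge> 1" for k using M2 by (simp add: T_def Suc_le_eq)
  have L1: "L k \<ge> 1" for k using c1 T1[of k] by (simp add: L_def Suc_le_eq)
  have D: "D > 0" using c1 by (simp add: D_def)
  have u: "u > 0" using M2 by (simp add: u_def)
  have sigma_pos: "\<sigma> k > 0" for k using D u by (simp add: \<sigma>_def)
  have cT: "real (c * T k) > 0" for k using c1 T1[of k] by (simp add: Suc_le_eq)
  have psi: "\<psi> (L k) > 0" for k using pos[OF L1] .
  have rho_nonneg: "\<rho> k \<ge> 0" for k
    unfolding \<rho>_def using sigma_pos[of k] psi[of k] cT[of k] by simp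
  have T_sigma: "real (c * T k) * \<sigma> k = real c * D * (1 / (real M ^ k) ^ ?n)" for k
    using M2 by (simp add: T_def \<sigma>_def u_def power_add power_mult_distrib
        power_mult[symmetric] mult.commute[of _ k] field_simps)
  define b where "b k = (\<rho> k / \<sigma> k) ^ ?m" for k
  \<comment> \<open>Up to a constant factor and the cut-off, \<open>b\<close> is the condensed
    series of \<open>\<psi>\<close> with ratio \<open>M ^ (n * m)\<close> and offset
    \<open>c ^ n\<close>.\<close>
  have b_alt: "b k = min ((1 / 64) ^ ?m) (real ((M ^ (?n * ?m)) ^ k) * \<psi> (c ^ ?n * (M ^ (?n * ?m)) ^
    k) / (real c * D) ^ ?m)" for k
  proof -
    have "\<rho> k / \<sigma> k = min (1 / 64) (root ?m (\<psi> (L k)) / (real (c * T k) * \<sigma> k))"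
      using sigma_pos[of k] by (simp add: \<rho>_def min_divide_distrib_right)
    moreover have "root ?m (\<psi> (L k)) / (real (c * T k) * \<sigma> k) \<ge> 0"
      using psi[of k] sigma_pos[of k] by simp
    ultimately have "b k = min ((1 / 64) ^ ?m) ((root ?m (\<psi> (L k)) / (real (c * T k) * \<sigma> k)) ^ ?m)"
      unfolding b_def by (simp only: min_power_nonneg)
    also have "(root ?m (\<psi> (L k)) / (real (c * T k) * \<sigma> k)) ^ ?m
        = \<psi> (L k) * ((real M ^ k) ^ ?n) ^ ?m / (real c * D) ^ ?m"
      unfolding T_sigma using psi[of k] by (simp add: power_divide power_mult_distrib)
    also have "((real M ^ k) ^ ?n) ^ ?m = real ((M ^ (?n * ?m)) ^ k)"
      by (simp add: power_mult[symmetric] ac_simps)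
    also have "L k = c ^ ?n * (M ^ (?n * ?m)) ^ k"
      by (simp add: L_def T_def power_mult_distrib power_mult[symmetric] ac_simps)
    finally show ?thesis by (simp add: mult.commute)
  qed
  have b_small: "b k \<le> 1 / (16 * 4 ^ ?m)" for k
  proof -
    have "b k \<le> (1 / 64) ^ ?m" unfolding b_alt by simp
    also have "(1 / 64 :: real) ^ ?m = (1 / 16) ^ ?m * (1 / 4) ^ ?m"
      by (simp add: power_mult_distrib[symmetric])
    also have "\<dots> \<le> (1 / 16) ^ 1 * (1 / 4) ^ ?m"
      by (intro mult_right_mono power_decreasing) (auto simp: Suc_le_eq)
    finally show ?thesis by (simp add: power_divide)
  qed
  \<comment> \<open>If \<open>b\<close> were summable it would tend to zero, so the constant in the
    minimum would eventually be inactive and the condensed series would converge.\<close>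
  have b_diverge: "\<not> summable b"
  proof
    assume "summable b"
    then have "b \<longlonglongrightarrow> 0" by (rule summable_LIMSEQ_zero)
    then have "\<forall>\<^sub>F k in sequentially. b k < (1 / 64) ^ ?m"
      by (rule order_tendstoD(2)) simp
    then have ev: "\<forall>\<^sub>F k in sequentially. b k * (real c * D) ^ ?m
        = real ((M ^ (?n * ?m)) ^ k) * \<psi> (c ^ ?n * (M ^ (?n * ?m)) ^ k)"
      by (rule eventually_mono) (use c1 D in \<open>auto simp: b_alt min_less_iff_disj min_def split:
        if_splits\<close>)
    have "summable (\<lambda>k. real ((M ^ (?n * ?m)) ^ k) * \<psi> (c ^ ?n * (M ^ (?n * ?m)) ^ k))"
      by (rule iffD1[OF summable_cong[OF ev] summable_mult2[OF \<open>summable b\<close>]])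
    moreover have "M ^ (?n * ?m) \<ge> 2"
      using M2 self_le_power[of M "?n * ?m"] by simp
    ultimately show False
      using not_summable_condensed[OF pos noninc diverge, of "M ^ (?n * ?m)" "c ^ ?n"] c1 by simp
  qed
  have S_countable: "countable (S k)" for k
  proof -
    have "S k \<subseteq> range (\<lambda>(p, q). y p q)" by (auto simp: S_def)
    then show ?thesis by (rule countable_subset) simp
  qed
  have F_borel: "F k0 \<in> sets borel" for k0
    unfolding F_def using S_countable by (intro borel_comp sets.countable_UN'') auto
  have "F k0 \<in> null_sets lborel" for k0
  proof (rule null_sets_if_porous[OF F_borel, of "1 / (64 * 24 ^ ?m)"])
    fix x0 :: "real^'m" and r :: real
    assume "r > 0"
    \<comment> \<open>The selected balls spread over radius \<open>2 * R\<close>, which must stay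
      inside the given ball.\<close>
    define R where "R = r / 2"
    have R: "R > 0" using \<open>r > 0\<close> by (simp add: R_def)
    have u_ge: "real M \<le> u"
      unfolding u_def using M2 power_increasing[of 1 "?m + ?n" "real M"] by (simp add: Suc_le_eq)
    have "\<forall>\<^sub>F k in sequentially. k0 \<le> k \<and> 2 * D * (1 / real M) ^ k \<le> R"
      using eventually_geometric_le[OF M2 R] by (intro eventually_conj eventually_ge_at_top)
    with eventually_congruent_solutions[OF M2 N eps R small K generic, of x0 w v]
    have "\<forall>\<^sub>F k in sequentially. (\<exists>Bad. Bad \<in> fmeasurable lborel \<and>
        measure lborel Bad \<le> measure lborel (ball x0 R) / 2 \<and>
        (\<forall>x\<in>ball x0 R - Bad. \<exists>z\<in>S k. dist x z \<le> \<sigma> k)) \<and> k0 \<le> k \<and> 2 * \<sigma> k \<le> R"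
    proof eventually_elim
      case (elim k)
      from elim(1) obtain Bad where Bad: "Bad \<in> fmeasurable lborel"
        "measure lborel Bad \<le> measure lborel (ball x0 R) / 2"
        and sol: "\<And>x. x \<in> ball x0 R - Bad \<Longrightarrow> \<exists>p q. good k p q \<and>
          supnorm (\<theta> *v of_int_vec q + real_of_int (q $ j0) *\<^sub>R x + of_int_vec p)
            \<le> real c * (1 / (real M ^ k) ^ ?n)"
        by (auto simp: good_def T_def c_def)
      have "\<exists>z\<in>S k. dist x z \<le> \<sigma> k" if x: "x \<in> ball x0 R - Bad" for x
      proof -
        obtain p q where pq: "good k p q"
          "supnorm (\<theta> *v of_int_vec q + real_of_int (q $ j0) *\<^sub>R x + of_int_vec p)
            \<le> real c * (1 / (real M ^ k) ^ ?n)"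
          using sol[OF x] by blast
        have q: "real (T k) \<le> real_of_int (q $ j0)" using pq(1) by (simp add: good_def)
        have q_pos: "real_of_int (q $ j0) > 0" using q T1[of k] by linarith
        have "x - y p q = (1 / real_of_int (q $ j0)) *\<^sub>R (\<theta> *v of_int_vec q
          + real_of_int (q $ j0) *\<^sub>R x + of_int_vec p)"
          using q_pos by (simp add: y_def scaleR_right_distrib)
        then have "supnorm (x - y p q) = (1 / real_of_int (q $ j0))
            * supnorm (\<theta> *v of_int_vec q + real_of_int (q $ j0) *\<^sub>R x + of_int_vec p)"
          using q_pos by (simp add: supnorm_scaleR)
        also have "\<dots> \<le> (1 / real_of_int (q $ j0)) * (real c * (1 / (real M ^ k) ^ ?n))"
          using q_pos by (intro mult_left_mono pq(2)) simp
        also have "\<dots> \<le> (1 / real (T k)) * (real c * (1 / (real M ^ k) ^ ?n))"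
          using q q_pos T1[of k] by (intro mult_right_mono divide_left_mono) auto
        also have "\<dots> = real c / u ^ k"
          using M2 by (simp add: T_def u_def power_add power_mult_distrib power_mult[symmetric]
            mult.commute[of _ k])
        finally have "real ?m * supnorm (x - y p q) \<le> real ?m * (real c / u ^ k)"
          by (rule mult_left_mono) simp
        then have "dist x (y p q) \<le> \<sigma> k"
          using norm_le_card_supnorm[of "x - y p q"] by (simp add: dist_norm \<sigma>_def D_def)
        then show ?thesis using pq(1) by (auto simp: S_def)
      qed
      moreover have "\<sigma> k \<le> D * (1 / real M) ^ k"
      proof -
        have "D / u ^ k \<le> D / real M ^ k"
          using D M2 u_ge by (intro divide_left_mono power_mono) auto
        then show ?thesis by (simp add: \<sigma>_def power_divide)
      qed
      ultimately show ?case using Bad elim(2) by auto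
    qed
    then obtain k1 where k1: "\<And>k. k \<ge> k1 \<Longrightarrow> (\<exists>Bad. Bad \<in> fmeasurable lborel \<and>
        measure lborel Bad \<le> measure lborel (ball x0 R) / 2 \<and>
        (\<forall>x\<in>ball x0 R - Bad. \<exists>z\<in>S k. dist x z \<le> \<sigma> k)) \<and> k0 \<le> k \<and> 2 * \<sigma> k \<le> R"
      unfolding eventually_sequentially by blast
    then obtain Bad where Bad: "\<And>k. k \<ge> k1 \<Longrightarrow> Bad k \<in> fmeasurable lborel"
      "\<And>k. k \<ge> k1 \<Longrightarrow> measure lborel (Bad k) \<le> measure lborel (ball x0 R) / 2"
      "\<And>k x. k \<ge> k1 \<Longrightarrow> x \<in> ball x0 R - Bad k \<Longrightarrow> \<exists>z\<in>S k. dist x z \<le> \<sigma> k"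
      by metis
    interpret ubiquitous_system S \<rho> \<sigma> b Bad x0 R u D k1
    proof
      show "4 ^ DIM(real^'m) * 2 ^ DIM(real^'m) * 16 \<le> u"
      proof -
        have "real (4 ^ ?m * 2 ^ ?m * 16) \<le> real M" using M by (simp only: of_nat_le_iff)
        then show ?thesis using u_ge by simp
      qed
      show "\<rho> k \<le> \<sigma> k" for k
        using sigma_pos[of k] by (simp add: \<rho>_def min_le_iff_disj)
    qed (use R D k1 rho_nonneg Bad in \<open>auto simp: \<sigma>_def b_def\<close>)
    obtain E where E: "E \<in> fmeasurable lborel" "E \<subseteq> (\<Union>k\<in>{k1..}. \<Union>z\<in>S k. cball z (\<rho> k))"
      "E \<subseteq> ball x0 (2 * R)"
      "measure lborel (ball x0 (2 * R)) \<le> 64 * 24 ^ DIM(real^'m) * measure lborel E"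
      by (rule limsup_volume) (use b_small b_diverge in auto)
    have "k1 \<ge> k0" using k1[of k1] by simp
    then have "E \<subseteq> ball x0 r - F k0"
      using E(2,3) by (fastforce simp: F_def R_def)
    then have le: "emeasure lborel E \<le> emeasure lborel (ball x0 r - F k0)"
      using F_borel by (intro emeasure_mono) auto
    have ball: "emeasure lborel (ball x0 r) = ennreal (measure lborel (ball x0 r))"
      using emeasure_bounded_finite[OF bounded_ball, of x0 r] by (intro emeasure_eq_ennreal_measure) auto
    have Em: "emeasure lborel E = ennreal (measure lborel E)"
      using E(1) by (intro emeasure_eq_ennreal_measure) (auto simp: fmeasurable_def)
    have "1 / (64 * 24 ^ ?m) * measure lborel (ball x0 r) \<le> measure lborel E"
      using E(4) by (simp add: R_def divide_le_eq mult.commute)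
    then have "ennreal (1 / (64 * 24 ^ ?m) * measure lborel (ball x0 r)) \<le> emeasure lborel E"
      unfolding Em by (rule ennreal_leI)
    also have "ennreal (1 / (64 * 24 ^ ?m) * measure lborel (ball x0 r))
        = ennreal (1 / (64 * 24 ^ ?m)) * ennreal (measure lborel (ball x0 r))"
      by (rule ennreal_mult) simp_all
    also note le
    finally show "ennreal (1 / (64 * 24 ^ ?m)) * emeasure lborel (ball x0 r)
      \<le> emeasure lborel (ball x0 r - F k0)"
      unfolding ball .
  qed simp
  then have "AE x in lborel. \<forall>k0. x \<notin> F k0"
    by (simp add: AE_all_countable AE_not_in)
  then show ?thesis
  proof (rule AE_mp, intro AE_I2 impI)
    fix x assume x: "\<forall>k0. x \<notin> F k0"
    let ?A = "congruent_solutions \<psi> N w v (\<theta> + column_matrix j0 x)"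
    have "\<exists>z\<in>?A. int k0 \<le> snd z $ j0" for k0
    proof -
      obtain k p q where k: "k0 \<le> k" and good: "good k p q" and near: "dist (y p q) x \<le> \<rho> k"
        using x[rule_format, of k0] by (auto simp: F_def S_def)
      have q: "real (T k) \<le> real_of_int (q $ j)" "real_of_int (q $ j) \<le> real c * real (T k)" for j
        using good by (simp_all add: good_def)
      have q_pos: "real_of_int (q $ j) > 0" for j using q(1)[of j] T1[of k] by linarith
      have "(\<theta> + column_matrix j0 x) *v of_int_vec q + of_int_vec p
        = real_of_int (q $ j0) *\<^sub>R (x - y p q)"
        using q_pos[of j0] by (simp add: add_column_matrix_mult y_def scaleR_right_distrib
          scaleR_right_diff_distrib)
      then have "supnorm ((\<theta> + column_matrix j0 x) *v of_int_vec q + of_int_vec p)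
          = real_of_int (q $ j0) * supnorm (x - y p q)"
        using q_pos[of j0] by (simp add: supnorm_scaleR)
      also have "\<dots> \<le> real (c * T k) * \<rho> k"
        using q(2)[of j0] q_pos[of j0] near supnorm_le_norm[of "x - y p q"] cT[of k]
          supnorm_nonneg[of "x - y p q"]
        by (intro mult_mono) (auto simp: dist_norm norm_minus_commute)
      also have "\<dots> \<le> real (c * T k) * (root ?m (\<psi> (L k)) / real (c * T k))"
        using cT[of k] by (intro mult_left_mono) (auto simp: \<rho>_def)
      also have "\<dots> = root ?m (\<psi> (L k))" using c1 T1[of k] by (simp add: Suc_le_eq)
      finally have "supnorm ((\<theta> + column_matrix j0 x) *v of_int_vec q + of_int_vec p) ^ ?m
        \<le> root ?m (\<psi> (L k)) ^ ?m"
        by (intro power_mono supnorm_nonneg)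
      also have "\<dots> = \<psi> (L k)" using psi[of k] by simp
      \<comment> \<open>All coordinates of \<open>q\<close> lie between \<open>T k\<close> and
        \<open>c * T k\<close>, so its height is at least \<open>1\<close> and monotonicity applies
        up to \<open>L k\<close>.\<close>
      also have "\<dots> \<le> \<psi> (nat (supnorm q ^ ?n))"
      proof (rule noninc)
        have "q $ j0 > 0" using q_pos[of j0] by simp
        then have "1 \<le> supnorm q" using abs_le_supnorm[of q j0] by linarith
        then have "1 \<le> supnorm q ^ ?n" by (rule one_le_power)
        then show "1 \<le> nat (supnorm q ^ ?n)" by simp
        have "q $ j \<le> int (c * T k)" for j
          using q(2)[of j] by (metis of_int_le_iff of_int_of_nat_eq of_nat_mult)
        then have "supnorm q \<le> int (c * T k)"
          using q_pos by (simp add: supnorm_le_iff abs_of_pos)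
        then have "supnorm q ^ ?n \<le> int (c * T k) ^ ?n"
          by (intro power_mono supnorm_nonneg)
        then show "nat (supnorm q ^ ?n) \<le> L k"
          unfolding L_def by (simp only: nat_le_iff of_nat_power)
      qed
      finally have mem: "(p, q) \<in> ?A"
        using good by (simp add: congruent_solutions_def good_def)
      have "k0 \<le> T k"
      proof -
        have "k < M ^ k" using M2 by (intro power_gt_expt) simp
        also have "\<dots> \<le> T k" unfolding T_def using M2 by (intro self_le_power) auto
        finally show ?thesis using k by simp
      qed
      then have "real k0 \<le> real_of_int (q $ j0)" using q(1)[of j0] by linarith
      then have "int k0 \<le> q $ j0" by (metis of_int_le_iff of_int_of_nat_eq)
      then show ?thesis using mem by (intro bexI[of _ "(p, q)"]) auto
    qed
    then have unbounded: "\<exists>z\<in>?A. int k0 \<le> snd z $ j0" for k0 .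
    show "infinite ?A"
    proof
      assume "finite ?A"
      then have "finite ((\<lambda>z. nat (snd z $ j0)) ` ?A)" by simp
      then obtain k0 where "\<forall>z\<in>?A. nat (snd z $ j0) \<le> k0"
        by (auto simp: finite_nat_set_iff_bounded_le)
      then show False using unbounded[of "Suc k0"] by fastforce
    qed
  qed
qed

theorem theorem1p2:
  fixes \<psi> :: "nat \<Rightarrow> real"
    and Np :: "'m::finite \<Rightarrow> nat" and Nq :: "'n::finite \<Rightarrow> nat"
    and vp :: "'m \<Rightarrow> int" and vq :: "'n \<Rightarrow> int"
  assumes pos: "\<And>k. k \<ge> 1 \<Longrightarrow> \<psi> k > 0"
    and noninc: "\<And>a b. 1 \<le> a \<Longrightarrow> a \<le> b \<Longrightarrow> \<psi> b \<le> \<psi> a"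
    and diverge: "\<not> summable \<psi>"
    and Np_pos: "\<And>j. Np j \<ge> 1" and Nq_pos: "\<And>j. Nq j \<ge> 1"
  shows "AE \<theta> in (lborel :: (real^'n^'m) measure).
    infinite {(p :: int^'m, q :: int^'n).
       supnorm (\<theta> *v (\<chi> j. real_of_int (q $ j)) + (\<chi> i. real_of_int (p $ i))) ^ CARD('m)
         \<le> \<psi> (nat (supnorm q ^ CARD('n)))
     \<and> (\<forall>j. p $ j mod int (Np j) = vp j mod int (Np j))
     \<and> (\<forall>j. q $ j mod int (Nq j) = vq j mod int (Nq j))}"
proof -
  let ?m = "CARD('m)" and ?n = "CARD('n)"
  \<comment> \<open>Any common multiple of the moduli would do.\<close>
  define N where "N = (\<Prod>i\<in>UNIV. Np i) * (\<Prod>j\<in>UNIV. Nq j)"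
  define w :: "int^'m" where "w = (\<chi> i. vp i)"
  define v :: "int^'n" where "v = (\<chi> j. vq j)"
  define M :: nat where "M = 4 ^ ?m * 2 ^ ?m * 16"
  \<comment> \<open>An arbitrary column; the argument is the same for each.\<close>
  define j0 :: 'n where "j0 = undefined"
  have N: "N \<ge> 1"
    using Np_pos Nq_pos by (simp add: N_def Suc_le_eq prod_pos)
  have M2: "M \<ge> 2"
  proof -
    have "(1::nat) * 1 * 16 \<le> M"
      unfolding M_def by (intro mult_mono) auto
    then show ?thesis by linarith
  qed
  \<comment> \<open>Solves the smallness condition for a first power; as
    \<open>\<epsilon> \<le> 1\<close>, the power \<open>m + n\<close> is smaller still.\<close>
  define a where "a = unit_ball_vol (real ?m) / (4 * (3 ^ ?n * 8 ^ ?m))"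
  define \<epsilon> where "\<epsilon> = min (1 / 2) a"
  have a: "a > 0" by (simp add: a_def)
  have eps: "0 < \<epsilon>" "\<epsilon> \<le> 1 / 2" using a by (auto simp: \<epsilon>_def)
  have small: "3 ^ ?n * 8 ^ ?m * \<epsilon> ^ (?m + ?n) \<le> unit_ball_vol (real ?m) / 4"
  proof -
    have "\<epsilon> ^ (?m + ?n) \<le> \<epsilon> ^ 1"
      using eps by (intro power_decreasing) (auto simp: Suc_le_eq)
    also have "\<dots> \<le> a" by (simp add: \<epsilon>_def)
    finally have "3 ^ ?n * 8 ^ ?m * \<epsilon> ^ (?m + ?n) \<le> 3 ^ ?n * 8 ^ ?m * a"
      by (intro mult_left_mono) auto
    then show ?thesis by (simp add: a_def)
  qed
  obtain K :: nat where "1 / \<epsilon> ^ (?m + ?n) < real K" using reals_Archimedean2 by blast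
  then have K: "real K * \<epsilon> ^ (?m + ?n) > 1"
    using eps by (simp add: divide_less_eq)
  have "AE \<theta> in (lborel :: (real^'n^'m) measure). AE x in lborel.
      infinite (congruent_solutions \<psi> N w v (\<theta> + column_matrix j0 x))"
    using AE_no_short_vector_in_slab[OF M2 eps, where ?'m = 'm and ?j0.0 = j0]
  proof (rule eventually_mono)
    fix \<theta> :: "real^'n^'m"
    assume generic: "\<forall>\<^sub>F k in sequentially. \<forall>p q. q \<noteq> 0 \<longrightarrow> q $ j0 = 0 \<longrightarrow>
      supnorm (of_int_vec q) \<le> \<epsilon> * (real M ^ k) ^ ?m \<longrightarrow>
      \<not> supnorm (\<theta> *v of_int_vec q + of_int_vec p) \<le> \<epsilon> / (real M ^ k) ^ ?n"
    show "AE x in lborel. infinite (congruent_solutions \<psi> N w v (\<theta> + column_matrix j0 x))"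
      by (rule AE_infinite_solutions_in_column[OF pos noninc diverge eq_imp_le[OF M_def[symmetric]] N eps
            small K generic])
  qed
  then have "AE \<theta> in (lborel :: (real^'n^'m) measure). infinite (congruent_solutions \<psi> N w v \<theta>)"
    by (rule AE_if_AE_column[OF measurable_infinite_solutions])
  then show ?thesis
  proof (rule AE_mp, intro AE_I2 impI)
    fix \<theta> :: "real^'n^'m"
    assume inf: "infinite (congruent_solutions \<psi> N w v \<theta>)"
    have dvd: "Np i dvd N" "Nq j dvd N" for i j
      unfolding N_def by (intro dvd_mult2 dvd_prodI; simp) (intro dvd_mult dvd_prodI; simp)
    have "p $ i mod int (Np i) = vp i mod int (Np i)" if "int N dvd p $ i - w $ i" for p i
      using dvd_trans[OF _ that, of "int (Np i)"] dvd(1)[of i] by (simp add: mod_eq_dvd_iff w_def)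
    moreover have "q $ j mod int (Nq j) = vq j mod int (Nq j)" if "int N dvd q $ j - v $ j" for q j
      using dvd_trans[OF _ that, of "int (Nq j)"] dvd(2)[of j] by (simp add: mod_eq_dvd_iff v_def)
    ultimately have "congruent_solutions \<psi> N w v \<theta> \<subseteq> {(p :: int^'m, q :: int^'n).
       supnorm (\<theta> *v (\<chi> j. real_of_int (q $ j)) + (\<chi> i. real_of_int (p $ i))) ^ CARD('m)
         \<le> \<psi> (nat (supnorm q ^ CARD('n)))
     \<and> (\<forall>j. p $ j mod int (Np j) = vp j mod int (Np j))
     \<and> (\<forall>j. q $ j mod int (Nq j) = vq j mod int (Nq j))}"
      by (auto simp: congruent_solutions_def of_int_vec_def)
    then show "infinite {(p :: int^'m, q :: int^'n).
       supnorm (\<theta> *v (\<chi> j. real_of_int (q $ j)) + (\<chi> i. real_of_int (p $ i))) ^ CARD('m)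
         \<le> \<psi> (nat (supnorm q ^ CARD('n)))
     \<and> (\<forall>j. p $ j mod int (Np j) = vp j mod int (Np j))
     \<and> (\<forall>j. q $ j mod int (Nq j) = vq j mod int (Nq j))}"
      using inf finite_subset by blast
  qed
qed

end
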